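(* Let $\mathcal{X}$ be a complete separable metric space, let $\nu$ be a diffuse, boundedly finite measure on $\mathcal{X}$, and let $\mathcal{P}(dN|\nu)$ be the law of a Poisson random measure $N$ on $\mathcal{X}$ with mean measure $\nu$. Then for every non-negative measurable function $f$ on $\mathcal{X}$ of bounded support and every non-negative measurable function $g$ on $\mathcal{M}$, $$\int_{\mathcal{M}} g(N)\,e^{-N(f)}\,\mathcal{P}(dN|\nu)=\mathcal{L}_N(f|\nu)\int_{\mathcal{M}} g(N)\,\mathcal{P}(dN|e^{-f}\nu),$$ where $\mathcal{P}(dN|e^{-f}\nu)$ is the law of a Poisson random measure with mean measure $e^{-f(x)}\nu(dx)$. In other words, $e^{-N(f)}\mathcal{P}(dN|\nu)=\mathcal{L}_N(f|\nu)\,\mathcal{P}(dN|e^{-f}\nu)$ as measures on $\mathcal{M}$.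
   Context: $\mathcal{M}$ is the space of boundedly finite measures on $\mathcal{X}$ (finite on bounded Borel sets) with its usual Borel $\sigma$-field. $N(f)=\int_{\mathcal{X}} f(x)N(dx)$. The Laplace functional of $N$ is $\mathcal{L}_N(f|\nu)=\int_{\mathcal{M}}e^{-N(f)}\mathcal{P}(dN|\nu)=\exp\left(-\int_{\mathcal{X}}(1-e^{-f(x)})\nu(dx)\right)$. *)

theory Defs
  imports "HOL-Probability.Probability"
begin

definition boundedly_finite :: "'a::metric_space measure \<Rightarrow> bool" where
  "boundedly_finite \<mu> \<longleftrightarrow>
     sets \<mu> = sets borel \<and> (\<forall>A\<in>sets borel. bounded A \<longrightarrow> emeasure \<mu> A < \<infinity>)"

definition diffuse :: "'a measure \<Rightarrow> bool" where
  "diffuse \<mu> \<longleftrightarrow> (\<forall>x. emeasure \<mu> {x} = 0)"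

text \<open>
  The weak-hash topology on the boundedly finite measures: the coarsest topology for which
  \<open>\<mu> \<mapsto> \<integral>h d\<mu>\<close> is continuous for every bounded continuous \<open>h\<close>
  vanishing outside a bounded set.  All these integrals exist, since \<open>\<mu>\<close> is boundedly finite.
\<close>

definition weak_hash_topology :: "'a::metric_space measure topology" where
  "weak_hash_topology = topology_generated_by
     {{\<mu>. boundedly_finite \<mu> \<and> integral\<^sup>L \<mu> h \<in> U} | (h :: 'a \<Rightarrow> real) U.
        continuous_on UNIV h \<and> bounded (range h) \<and> bounded {x. h x \<noteq> 0} \<and> open U}"

definition bfm_space :: "'a::metric_space measure measure" where
  "bfm_space = sigma (topspace weak_hash_topology) {U. openin weak_hash_topology U}"

lemma topspace_weak_hash_topology: "topspace weak_hash_topology = {\<mu>. boundedly_finite \<mu>}"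
proof -
  have "{\<mu>::'a measure. boundedly_finite \<mu>} \<in>
     {{\<mu>. boundedly_finite \<mu> \<and> integral\<^sup>L \<mu> h \<in> U} | (h :: 'a \<Rightarrow> real) U.
        continuous_on UNIV h \<and> bounded (range h) \<and> bounded {x. h x \<noteq> 0} \<and> open U}"
    by (rule CollectI, rule exI[of _ "\<lambda>_. 0"], rule exI[of _ UNIV]) auto
  then show ?thesis
    unfolding weak_hash_topology_def topology_generated_by_topspace by blast
qed

lemma space_bfm_space: "space bfm_space = {\<mu>. boundedly_finite \<mu>}"
  unfolding bfm_space_def topspace_weak_hash_topology[symmetric]
  by (rule space_measure_of) (auto dest: openin_subset)

lemma sets_bfm_space:
  "sets bfm_space = sigma_sets {\<mu>. boundedly_finite \<mu>} {U. openin weak_hash_topology U}"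
  unfolding bfm_space_def topspace_weak_hash_topology[symmetric]
  by (rule sets_measure_of) (auto dest: openin_subset)

text \<open>
  In the condition on the law of \<open>N A\<close>, \<open>\<nu> A = 0\<close> is covered by \<open>0 ^ 0 = 1\<close>:
  then \<open>N A = 0\<close> almost surely.
\<close>

definition poisson_random_measure ::
  "'b measure \<Rightarrow> 'a::metric_space measure \<Rightarrow> ('b \<Rightarrow> 'a measure) \<Rightarrow> bool" where
  "poisson_random_measure \<Omega> \<nu> N \<longleftrightarrow>
     prob_space \<Omega> \<and>
     N \<in> measurable \<Omega> bfm_space \<and>
     (\<forall>A\<in>sets borel. bounded A \<longrightarrow>
        (\<forall>k::nat. measure \<Omega> {\<omega>\<in>space \<Omega>. emeasure (N \<omega>) A = of_nat k}
                   = measure \<nu> A ^ k / fact k * exp (- measure \<nu> A))) \<and>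
     (\<forall>n (A :: nat \<Rightarrow> 'a set).
        (\<forall>i<n. A i \<in> sets borel \<and> bounded (A i)) \<and> disjoint_family_on A {..<n} \<longrightarrow>
        prob_space.indep_vars \<Omega> (\<lambda>_. borel) (\<lambda>i \<omega>. emeasure (N \<omega>) (A i)) {..<n})"

definition exp_neg :: "ennreal \<Rightarrow> ennreal" where
  "exp_neg t = (if t = \<infinity> then 0 else ennreal (exp (- enn2real t)))"

text \<open>
  For \<open>f \<ge> 0\<close> this is \<open>exp (- \<mu>(f))\<close>.  A boundedly finite \<open>\<mu>\<close> can have
  \<open>\<mu>(f) = \<infinity>\<close>, because \<open>f\<close> need not be bounded; the value is then \<open>0\<close>.
\<close>

definition exp_neg_integral :: "('a \<Rightarrow> real) \<Rightarrow> 'a measure \<Rightarrow> ennreal" where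
  "exp_neg_integral f \<mu> = exp_neg (\<integral>\<^sup>+ x. ennreal (f x) \<partial>\<mu>)"

definition laplace_functional :: "'a measure measure \<Rightarrow> ('a \<Rightarrow> real) \<Rightarrow> ennreal" where
  "laplace_functional P f = (\<integral>\<^sup>+ \<mu>. exp_neg_integral f \<mu> \<partial>P)"

end

theory Submission
  imports Defs
begin

text \<open>
  The Laplace functional of a Poisson random measure is
  \<open>u \<mapsto> exp (- \<integral>(1 - e\<^sup>-\<^sup>u) d\<nu>)\<close>, by independence for simple \<open>u\<close> and by monotone limits in
  general.  Since \<open>1 - e\<^sup>-\<^sup>f\<^sup>-\<^sup>u = (1 - e\<^sup>-\<^sup>f) + e\<^sup>-\<^sup>f (1 - e\<^sup>-\<^sup>u)\<close>, the two measures in the theorem have the same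
  Laplace functional, and a finite measure on the space of boundedly finite measures is determined
  by its Laplace functional.  For the last point, the Borel sets of the weak-hash topology are
  generated by the evaluations \<open>\<mu> \<mapsto> \<mu> A\<close>, \<open>A\<close> bounded, and the joint law of finitely many evaluations is
  determined by the moments of the \<open>[0,1]\<close>-valued variables \<open>exp (- \<mu> A)\<close>.
\<close>

section \<open>The function \<open>exp_neg\<close>\<close>

text \<open>The obstacle is the sigma-field. It is generated by all open sets of a topology with an
  uncountable subbasis, whereas a Poisson random measure is specified through its evaluations. To
  see that open sets are measurable for the evaluations, arbitrary unions must be replaced by
  countable ones. Separability permits this: a lower semicontinuous function is the supremum of
  countably many rational multiples of indicators of basic open sets, and the integrals of finite
  maxima of these give countably many tests. Since \<open>f\<close> may be unbounded, \<mu>(f) may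
  be infinite. Extending exp (- t) by 0 at infinity keeps it multiplicative and continuous, so
  adding exponents and passing to limits need no finiteness conditions. The variables exp (- \<mu>
  A) suit the uniqueness argument for two reasons: their moments are themselves values of Laplace
  functionals, and they live on a compact interval, where polynomials are uniformly dense among
  continuous functions. The identity of measures comes first; the identity for \<open>g\<close> is
  then read off by integrating \<open>g\<close> against both sides.\<close>

lemma exp_neg_ennreal: "0 \<le> t \<Longrightarrow> exp_neg (ennreal t) = ennreal (exp (- t))"
  by (simp add: exp_neg_def)

lemma exp_neg_top [simp]: "exp_neg \<top> = 0"
  by (simp add: exp_neg_def)

lemma exp_neg_0 [simp]: "exp_neg 0 = 1"
  by (simp add: exp_neg_def)

lemma exp_neg_add: "exp_neg (s + t) = exp_neg s * exp_neg t"
  by (cases s; cases t) (auto simp: exp_neg_ennreal mult_exp_exp simp flip: ennreal_plus ennreal_mult)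

lemma exp_neg_antimono: "s \<le> t \<Longrightarrow> exp_neg t \<le> exp_neg s"
  by (cases s; cases t) (auto simp: exp_neg_ennreal top_unique)

lemma exp_neg_le_1: "exp_neg t \<le> 1"
  using exp_neg_antimono[of 0 t] by simp

lemma exp_neg_less_top: "exp_neg t < \<top>"
  using exp_neg_le_1[of t] by (rule le_less_trans) simp

lemma exp_neg_of_nat_mult: "exp_neg (of_nat k * t) = exp_neg t ^ k"
  by (induction k) (simp_all add: exp_neg_add distrib_right)

lemma exp_neg_sum: "exp_neg (\<Sum>i\<in>I. t i) = (\<Prod>i\<in>I. exp_neg (t i))"
  by (induction I rule: infinite_finite_induct) (simp_all add: exp_neg_add)

lemma borel_measurable_exp_neg [measurable]: "exp_neg \<in> borel_measurable borel"
  unfolding exp_neg_def[abs_def] by measurable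

text \<open>Continuity includes the point at infinity, so limits can be taken even when integrals of
  a fixed measure diverge.\<close>

lemma tendsto_exp_neg:
  assumes "(t \<longlongrightarrow> l) F"
  shows "((\<lambda>n. exp_neg (t n)) \<longlongrightarrow> exp_neg l) F"
proof (cases "l = \<top>")
  case False
  then have "eventually (\<lambda>n. t n < \<top>) F"
    using order_tendstoD(2)[OF assms, of \<top>] by (simp add: less_top)
  then have ev: "eventually (\<lambda>n. exp_neg (t n) = ennreal (exp (- enn2real (t n)))) F"
    by eventually_elim (auto simp: exp_neg_def)
  have "((\<lambda>n. ennreal (exp (- enn2real (t n)))) \<longlongrightarrow> ennreal (exp (- enn2real l))) F"
    using assms False by (intro tendsto_ennrealI tendsto_intros) (auto simp: less_top)
  then show ?thesis
    using False by (subst tendsto_cong[OF ev]) (simp add: exp_neg_def)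
next
  case True
  have "eventually (\<lambda>n. exp_neg (t n) < x) F" if "0 < x" for x
  proof -
    \<comment> \<open>The bound \<open>y < 1\<close> makes \<open>- ln y\<close> nonnegative, so
      that \<open>exp_neg_ennreal\<close> applies; \<open>- ln y\<close> is the threshold beyond
      which \<open>exp_neg\<close> is at most \<open>y\<close>.\<close>
    obtain y where y: "0 < y" "y < 1" "ennreal y < x"
    proof -
      obtain z where z: "0 < z" "z < min x 1"
        using dense[of 0 "min x 1"] \<open>0 < x\<close> by auto
      then show thesis
        by (intro that[of "enn2real z"]; cases z) (auto simp: top_unique)
    qed
    have "eventually (\<lambda>n. ennreal (- ln y) < t n) F"
      using order_tendstoD(1)[OF assms, of "ennreal (- ln y)"] True by simp
    then show ?thesis
    proof eventually_elim
      case (elim n)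
      have "exp_neg (t n) \<le> exp_neg (ennreal (- ln y))"
        using elim by (intro exp_neg_antimono) simp
      also have "\<dots> = ennreal y"
        using y by (subst exp_neg_ennreal) auto
      finally show ?case using y by simp
    qed
  qed
  then show ?thesis
    using True by (intro order_tendstoI) auto
qed

section \<open>Borel sets of the weak-hash topology\<close>

lemma boundedly_finiteD:
  assumes "boundedly_finite \<mu>"
  shows "sets \<mu> = sets borel" "space \<mu> = UNIV"
    and "\<And>A. A \<in> sets borel \<Longrightarrow> bounded A \<Longrightarrow> emeasure \<mu> A < \<top>"
  using assms sets_eq_imp_space_eq[of \<mu> borel] by (auto simp: boundedly_finite_def)

text \<open>The kernel \<open>K\<close> and the space \<open>M\<close> are abstract because this is
  applied to three sigma-fields: the Borel field of the weak-hash topology, the field generated by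
  the evaluations, and the field of the probability space that carries \<open>N\<close>.\<close>

lemma measurable_nn_integral_of_bounded_sets:
  fixes K :: "'b \<Rightarrow> 'a::metric_space measure"
  assumes K: "\<And>\<omega>. \<omega> \<in> space M \<Longrightarrow> sets (K \<omega>) = sets borel"
    and meas: "\<And>A. A \<in> sets borel \<Longrightarrow> bounded A \<Longrightarrow> (\<lambda>\<omega>. emeasure (K \<omega>) A) \<in> borel_measurable M"
    and u: "u \<in> borel_measurable borel"
  shows "(\<lambda>\<omega>. \<integral>\<^sup>+ x. u x \<partial>K \<omega>) \<in> borel_measurable M"
  using u
proof (induction rule: borel_measurable_induct)
  case (cong f g)
  then show ?case by (simp add: fun_eq_iff[symmetric])
next
  case (set A)
  \<comment> \<open>Only evaluations at bounded sets are known to be measurable, so \<open>A\<close>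
    is exhausted by its traces on balls. The centre is arbitrary, hence
    \<open>undefined\<close>.\<close>
  define B where "B k = A \<inter> ball undefined (real k)" for k
  have B: "B k \<in> sets borel" "bounded (B k)" for k
    using set by (auto simp: B_def intro: bounded_subset[OF bounded_ball])
  have UN: "(\<Union>k. B k) = A"
    by (auto simp: B_def intro: reals_Archimedean2)
  have "incseq B"
    by (auto simp: B_def incseq_def)
  have "(\<lambda>\<omega>. SUP k. emeasure (K \<omega>) (B k)) \<in> borel_measurable M"
    using meas B by (intro borel_measurable_SUP) auto
  then show ?case
  proof (rule measurable_cong[THEN iffD1, rotated])
    fix \<omega> assume "\<omega> \<in> space M"
    then have s: "sets (K \<omega>) = sets borel" by (rule K)
    have "(SUP k. emeasure (K \<omega>) (B k)) = emeasure (K \<omega>) (\<Union>k. B k)"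
      using B s \<open>incseq B\<close> by (intro SUP_emeasure_incseq) auto
    then show "(SUP k. emeasure (K \<omega>) (B k)) = (\<integral>\<^sup>+ x. indicator A x \<partial>K \<omega>)"
      using set s by (simp add: UN)
  qed
next
  case (mult u c)
  have "(\<lambda>\<omega>. c * (\<integral>\<^sup>+ x. u x \<partial>K \<omega>)) \<in> borel_measurable M"
    using mult by measurable
  then show ?case
    by (rule measurable_cong[THEN iffD1, rotated])
      (use mult K in \<open>auto intro!: nn_integral_cmult[symmetric] simp: measurable_cong_sets[OF K refl]\<close>)
next
  case (add u v)
  have "(\<lambda>\<omega>. (\<integral>\<^sup>+ x. v x \<partial>K \<omega>) + (\<integral>\<^sup>+ x. u x \<partial>K \<omega>)) \<in> borel_measurable M"
    using add by measurable
  then show ?case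
    by (rule measurable_cong[THEN iffD1, rotated])
      (use add K in \<open>auto intro!: nn_integral_add[symmetric] simp: measurable_cong_sets[OF K refl]\<close>)
next
  case (seq U)
  have "(\<lambda>\<omega>. SUP i. \<integral>\<^sup>+ x. U i x \<partial>K \<omega>) \<in> borel_measurable M"
    using seq by measurable
  then show ?case
    unfolding \<open>u = (SUP i. U i)\<close> SUP_apply
    by (rule measurable_cong[THEN iffD1, rotated])
      (use seq K in \<open>auto intro!: nn_integral_monotone_convergence_SUP[symmetric]
        simp: measurable_cong_sets[OF K refl]\<close>)
qed

lemma tendsto_nn_integral_SUP:
  fixes U :: "nat \<Rightarrow> 'a \<Rightarrow> ennreal"
  assumes "incseq U" "\<And>i. U i \<in> borel_measurable M" "\<And>x. (SUP i. U i x) = u x"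
  shows "(\<lambda>i. \<integral>\<^sup>+ x. U i x \<partial>M) \<longlonglongrightarrow> (\<integral>\<^sup>+ x. u x \<partial>M)"
proof (rule nn_integral_LIMSEQ[OF assms(1,2)])
  fix x
  have "incseq (\<lambda>i. U i x)"
    using assms(1) by (auto simp: incseq_def le_fun_def)
  then show "(\<lambda>i. U i x) \<longlonglongrightarrow> u x"
    using LIMSEQ_SUP[of "\<lambda>i. U i x"] assms(3) by simp
qed

section \<open>Evaluations are Borel functions for the weak-hash topology\<close>

lemma open_indicator_approximation:
  fixes U :: "'a::metric_space set"
  assumes "open U"
  obtains h :: "nat \<Rightarrow> 'a \<Rightarrow> real"
  where "\<And>n. continuous_on UNIV (h n)" "\<And>n x. 0 \<le> h n x" "\<And>n x. h n x \<le> 1"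
    and "\<And>n x. x \<notin> U \<Longrightarrow> h n x = 0" "\<And>x. incseq (\<lambda>n. h n x)"
    and "\<And>x. (\<lambda>n. h n x) \<longlonglongrightarrow> indicator U x"
\<comment> \<open>The whole space is separated because the distance to the empty set is 0 by
  convention, so the formula below would give 0 instead of 1.\<close>
proof (cases "U = UNIV")
  case True
  then show thesis
    by (intro that[of "\<lambda>_ _. 1"]) (auto simp: incseq_def)
next
  case False
  define h where "h n x = min 1 (real n * infdist x (- U))" for n x
  show thesis
  proof (rule that[of h])
    show "continuous_on UNIV (h n)" for n
      unfolding h_def by (intro continuous_intros)
    show "0 \<le> h n x" "h n x \<le> 1" for n x
      by (auto simp: h_def infdist_nonneg)
    show "h n x = 0" if "x \<notin> U" for n x
      using that by (simp add: h_def)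
    show "incseq (\<lambda>n. h n x)" for x
      unfolding incseq_def h_def by (intro allI impI min.mono mult_right_mono infdist_nonneg) auto
    show "(\<lambda>n. h n x) \<longlonglongrightarrow> indicator U x" for x
    proof (cases "x \<in> U")
      case True
      then have pos: "0 < infdist x (- U)"
        using assms False by (intro infdist_pos_not_in_closed) auto
      obtain m where m: "1 < real m * infdist x (- U)"
        using pos reals_Archimedean3 by blast
      have "eventually (\<lambda>n. h n x = 1) sequentially"
        using eventually_ge_at_top[of m]
      proof eventually_elim
        case (elim n)
        have "1 \<le> real n * infdist x (- U)"
          using m elim pos by (intro order_trans[OF less_imp_le[OF m]] mult_right_mono) auto
        then show ?case by (simp add: h_def)
      qed
      then show ?thesis
        using True by (simp add: tendsto_eventually)
    qed (simp add: h_def)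
  qed
qed

lemma measurable_integral_bfm_space:
  fixes h :: "'a::metric_space \<Rightarrow> real"
  assumes "continuous_on UNIV h" "bounded (range h)" "bounded {x. h x \<noteq> 0}"
  shows "(\<lambda>\<mu>. integral\<^sup>L \<mu> h) \<in> borel_measurable bfm_space"
proof (rule borel_measurableI)
  fix V :: "real set" assume "open V"
  then have "openin weak_hash_topology {\<mu>. boundedly_finite \<mu> \<and> integral\<^sup>L \<mu> h \<in> V}"
    unfolding weak_hash_topology_def using assms
    by (intro topology_generated_by_Basis) auto
  then have "{\<mu>. boundedly_finite \<mu> \<and> integral\<^sup>L \<mu> h \<in> V} \<in> sets bfm_space"
    unfolding sets_bfm_space by (intro sigma_sets.Basic) simp
  also have "{\<mu>. boundedly_finite \<mu> \<and> integral\<^sup>L \<mu> h \<in> V}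
      = (\<lambda>\<mu>. integral\<^sup>L \<mu> h) -` V \<inter> space bfm_space"
    by (auto simp: space_bfm_space)
  finally show "(\<lambda>\<mu>. integral\<^sup>L \<mu> h) -` V \<inter> space bfm_space \<in> sets bfm_space" .
qed

lemma nn_integral_less_top_boundedly_finite:
  assumes \<mu>: "boundedly_finite \<mu>" and h: "h \<in> borel_measurable borel"
    and le: "\<And>x. h x \<le> c" and c: "c < \<top>" and supp: "bounded {x. h x \<noteq> 0}"
  shows "(\<integral>\<^sup>+ x. h x \<partial>\<mu>) < \<top>"
proof -
  have B: "{x. h x \<noteq> 0} \<in> sets borel"
    using h by measurable
  have "(\<integral>\<^sup>+ x. h x \<partial>\<mu>) \<le> (\<integral>\<^sup>+ x. c * indicator {x. h x \<noteq> 0} x \<partial>\<mu>)"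
    by (intro nn_integral_mono) (auto simp: le indicator_def)
  also have "\<dots> = c * emeasure \<mu> {x. h x \<noteq> 0}"
    using B boundedly_finiteD(1)[OF \<mu>] by (simp add: nn_integral_cmult_indicator)
  also have "\<dots> < \<top>"
    using c boundedly_finiteD(3)[OF \<mu> B supp] by (simp add: ennreal_mult_less_top)
  finally show ?thesis .
qed

lemma integrable_boundedly_finite:
  fixes h :: "'a::metric_space \<Rightarrow> real"
  assumes \<mu>: "boundedly_finite \<mu>" and h: "h \<in> borel_measurable borel"
    and bdd: "bounded (range h)" and supp: "bounded {x. h x \<noteq> 0}"
  shows "integrable \<mu> h"
proof (rule integrableI_bounded)
  show "h \<in> borel_measurable \<mu>"
    using h unfolding measurable_cong_sets[OF boundedly_finiteD(1)[OF \<mu>] refl] .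
  obtain c where c: "\<And>x. norm (h x) \<le> c"
    using bdd unfolding bounded_iff by auto
  show "(\<integral>\<^sup>+ x. ennreal (norm (h x)) \<partial>\<mu>) < \<infinity>"
    using nn_integral_less_top_boundedly_finite[OF \<mu>, of "\<lambda>x. ennreal (norm (h x))" "ennreal c"] h c supp
    by (auto intro: ennreal_leI)
qed

text \<open>The continuous functions that increase to the indicator of \<open>U\<close> vanish
  outside \<open>U\<close>. As \<open>U\<close> is bounded, they are test functions of the topology,
  and monotone convergence gives \<mu> U as a limit of their integrals.\<close>

lemma measurable_emeasure_open_bfm_space:
  fixes U :: "'a::metric_space set"
  assumes U: "open U" "bounded U"
  shows "(\<lambda>\<mu>. emeasure \<mu> U) \<in> borel_measurable bfm_space"
proof -
  obtain h :: "nat \<Rightarrow> 'a \<Rightarrow> real"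
    where h: "\<And>n. continuous_on UNIV (h n)" "\<And>n x. 0 \<le> h n x" "\<And>n x. h n x \<le> 1"
    and h0: "\<And>n x. x \<notin> U \<Longrightarrow> h n x = 0" and inc: "\<And>x. incseq (\<lambda>n. h n x)"
    and lim: "\<And>x. (\<lambda>n. h n x) \<longlonglongrightarrow> indicator U x"
    using open_indicator_approximation[OF U(1)] by metis
  have hb: "bounded (range (h n))" for n
    using h(2,3) by (auto simp: bounded_iff abs_le_iff intro!: exI[of _ 1] order_trans[OF _ h(2)])
  have hs: "bounded {x. h n x \<noteq> 0}" for n
    using U(2) by (rule bounded_subset) (use h0 in auto)
  have hm: "h n \<in> borel_measurable borel" for n
    by (rule borel_measurable_continuous_onI[OF h(1)])
  show ?thesis
  proof (rule borel_measurable_LIMSEQ_order)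
    show "(\<lambda>\<mu>. ennreal (integral\<^sup>L \<mu> (h n))) \<in> borel_measurable bfm_space" for n
      using measurable_integral_bfm_space[OF h(1) hb hs] by measurable
    fix \<mu> :: "'a measure" assume "\<mu> \<in> space bfm_space"
    then have \<mu>: "boundedly_finite \<mu>"
      by (simp add: space_bfm_space)
    have "(\<lambda>n. \<integral>\<^sup>+ x. ennreal (h n x) \<partial>\<mu>) \<longlonglongrightarrow> (\<integral>\<^sup>+ x. ennreal (indicator U x) \<partial>\<mu>)"
    proof (rule nn_integral_LIMSEQ)
      show "incseq (\<lambda>n x. ennreal (h n x))"
        using inc by (auto simp: incseq_def le_fun_def intro!: ennreal_leI)
      show "(\<lambda>x. ennreal (h n x)) \<in> borel_measurable \<mu>" for n
        using hm[of n] unfolding measurable_cong_sets[OF boundedly_finiteD(1)[OF \<mu>] refl] by measurable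
    qed (intro tendsto_ennrealI lim)
    moreover have "(\<integral>\<^sup>+ x. ennreal (h n x) \<partial>\<mu>) = ennreal (integral\<^sup>L \<mu> (h n))" for n
      by (intro nn_integral_eq_integral integrable_boundedly_finite[OF \<mu> hm hb hs]) (auto simp: h)
    ultimately show "(\<lambda>n. ennreal (integral\<^sup>L \<mu> (h n))) \<longlonglongrightarrow> emeasure \<mu> U"
      using U(1) boundedly_finiteD(1)[OF \<mu>] by (simp add: ennreal_indicator)
  qed
qed

lemma measurable_emeasure_bfm_space:
  fixes A :: "'a::metric_space set"
  assumes A: "A \<in> sets borel" "bounded A"
  shows "(\<lambda>\<mu>. emeasure \<mu> A) \<in> borel_measurable bfm_space"
proof -
  obtain x r where r: "A \<subseteq> ball x r"
    using A(2) bounded_subset_ballD by blast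
  \<comment> \<open>All sets are cut down to one ball. There every measure is finite, so that
    complements turn into differences in the induction over the sigma-field.\<close>
  let ?B = "ball x r"
  have bf: "boundedly_finite \<mu>" if "\<mu> \<in> space bfm_space" for \<mu> :: "'a measure"
    using that by (simp add: space_bfm_space)
  have "Int_stable {S :: 'a set. open S}"
    by (auto simp: Int_stable_def)
  moreover have "{S :: 'a set. open S} \<subseteq> Pow UNIV" by simp
  moreover have "A \<in> sigma_sets UNIV {S. open S}"
    using A(1) by (simp add: borel_def)
  ultimately have "(\<lambda>\<mu>. emeasure \<mu> (A \<inter> ?B)) \<in> borel_measurable bfm_space"
  proof (induction rule: sigma_sets_induct_disjoint[consumes 3, case_names basic empty compl union])
    case (basic S)
    then show ?case
      by (intro measurable_emeasure_open_bfm_space) (auto intro: bounded_subset[OF bounded_ball])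
  next
    case empty
    show ?case by simp
  next
    case (compl S)
    have S: "S \<in> sets borel"
      using compl by (simp add: borel_def)
    have "(\<lambda>\<mu>. emeasure \<mu> ?B - emeasure \<mu> (S \<inter> ?B)) \<in> borel_measurable bfm_space"
      by (intro borel_measurable_minus_ennreal measurable_emeasure_open_bfm_space compl.IH) auto
    then show ?case
    proof (rule measurable_cong[THEN iffD1, rotated])
      fix \<mu> :: "'a measure" assume "\<mu> \<in> space bfm_space"
      note \<mu> = boundedly_finiteD[OF bf[OF this]]
      have "emeasure \<mu> (S \<inter> ?B) < \<top>"
        using S by (intro \<mu>(3)) (auto intro: bounded_subset[OF bounded_ball])
      then have "emeasure \<mu> (?B - S \<inter> ?B) = emeasure \<mu> ?B - emeasure \<mu> (S \<inter> ?B)"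
        using S \<mu>(1) by (intro emeasure_Diff) auto
      moreover have "?B - S \<inter> ?B = (UNIV - S) \<inter> ?B" by auto
      ultimately show "emeasure \<mu> ?B - emeasure \<mu> (S \<inter> ?B) = emeasure \<mu> ((UNIV - S) \<inter> ?B)"
        by simp
    qed
  next
    case (union S)
    have S: "S i \<in> sets borel" for i
      using union by (auto simp: borel_def)
    have "(\<lambda>\<mu>. \<Sum>i. emeasure \<mu> (S i \<inter> ?B)) \<in> borel_measurable bfm_space"
      using union by (intro borel_measurable_suminf_order) auto
    then show ?case
    proof (rule measurable_cong[THEN iffD1, rotated])
      fix \<mu> :: "'a measure" assume "\<mu> \<in> space bfm_space"
      note \<mu> = boundedly_finiteD[OF bf[OF this]]
      have "(\<Sum>i. emeasure \<mu> (S i \<inter> ?B)) = emeasure \<mu> (\<Union>i. S i \<inter> ?B)"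
        using S union(1) \<mu>(1) by (intro suminf_emeasure) (auto simp: disjoint_family_on_def)
      then show "(\<Sum>i. emeasure \<mu> (S i \<inter> ?B)) = emeasure \<mu> ((\<Union>i. S i) \<inter> ?B)"
        by simp
    qed
  qed
  then show ?thesis
    using r by (simp add: Int_absorb2)
qed

lemma measurable_nn_integral_bfm_space:
  fixes u :: "'a::metric_space \<Rightarrow> ennreal"
  assumes "u \<in> borel_measurable borel"
  shows "(\<lambda>\<mu>. \<integral>\<^sup>+ x. u x \<partial>\<mu>) \<in> borel_measurable bfm_space"
  by (rule measurable_nn_integral_of_bounded_sets[OF _ measurable_emeasure_bfm_space assms])
    (auto simp: space_bfm_space boundedly_finiteD)

section \<open>The evaluations generate all Borel sets of the weak-hash topology\<close>

text \<open>
  The members of \<open>T\<close> need not be open: it is enough that they refine the subbasis \<open>\<S>\<close>.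
\<close>

lemma openin_topology_generated_by_countable:
  assumes U: "openin (topology_generated_by \<S>) U"
    and T: "countable T"
    and refine: "\<And>S x. S \<in> \<S> \<Longrightarrow> x \<in> S \<Longrightarrow> \<exists>F. finite F \<and> F \<subseteq> T \<and> x \<in> \<Inter>F \<and> \<Omega> \<inter> \<Inter>F \<subseteq> S"
    and sub: "\<Union>\<S> \<subseteq> \<Omega>" "\<Union>T \<subseteq> \<Omega>"
  shows "U \<in> sigma_sets \<Omega> T"
proof -
  \<comment> \<open>Being covered pointwise by finite intersections from \<open>T\<close> survives
    finite intersections and arbitrary unions, so it passes from the subbasis to every open set. The
    intersection with \<open>\<Omega>\<close> matters for empty \<open>F\<close>, where
    \<open>\<Inter>F\<close> is \<open>UNIV\<close>.\<close>
  have loc: "\<forall>x\<in>U. \<exists>F. finite F \<and> F \<subseteq> T \<and> x \<in> \<Inter>F \<and> \<Omega> \<inter> \<Inter>F \<subseteq> U"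
    using openin_topology_generated_by[OF U]
  proof (induction rule: generate_topology_on.induct)
    case Empty
    show ?case by simp
  next
    case (Basis S)
    show ?case using refine[OF Basis] by (rule ballI)
  next
    case (Int a b)
    show ?case
    proof
      fix x assume "x \<in> a \<inter> b"
      then have "x \<in> a" "x \<in> b" by auto
      obtain F where "finite F" "F \<subseteq> T" "x \<in> \<Inter>F" "\<Omega> \<inter> \<Inter>F \<subseteq> a"
        using bspec[OF Int.IH(1) \<open>x \<in> a\<close>] by (elim exE conjE)
      moreover obtain G where "finite G" "G \<subseteq> T" "x \<in> \<Inter>G" "\<Omega> \<inter> \<Inter>G \<subseteq> b"
        using bspec[OF Int.IH(2) \<open>x \<in> b\<close>] by (elim exE conjE)
      ultimately show "\<exists>F. finite F \<and> F \<subseteq> T \<and> x \<in> \<Inter>F \<and> \<Omega> \<inter> \<Inter>F \<subseteq> a \<inter> b"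
        by (intro exI[of _ "F \<union> G"]) auto
    qed
  next
    case (UN K)
    show ?case
    proof
      fix x assume "x \<in> \<Union>K"
      then obtain k where k: "k \<in> K" "x \<in> k" by blast
      then obtain F where "finite F" "F \<subseteq> T" "x \<in> \<Inter>F" "\<Omega> \<inter> \<Inter>F \<subseteq> k"
        using bspec[OF UN.IH[OF k(1)] k(2)] by (elim exE conjE)
      with k show "\<exists>F. finite F \<and> F \<subseteq> T \<and> x \<in> \<Inter>F \<and> \<Omega> \<inter> \<Inter>F \<subseteq> \<Union>K"
        by (intro exI[of _ F]) auto
    qed
  qed
  \<comment> \<open>This makes the union countable: instead of one neighbourhood per point of
    \<open>U\<close>, take all finite \<open>F\<close> that fit into \<open>U\<close>. A countable
    \<open>T\<close> has only countably many finite subsets.\<close>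
  define I where "I = {F. finite F \<and> F \<subseteq> T \<and> \<Omega> \<inter> \<Inter>F \<subseteq> U}"
  have "countable I"
    using countable_Collect_finite_subset[OF T] by (rule countable_subset[rotated]) (auto simp: I_def)
  have "U \<subseteq> \<Omega>"
    using openin_subset[OF U] sub by simp
  then have "U = (\<Union>F\<in>I. \<Omega> \<inter> \<Inter>F)"
  proof (intro antisym subsetI)
    fix x assume x: "x \<in> U"
    then obtain F where "finite F" "F \<subseteq> T" "x \<in> \<Inter>F" "\<Omega> \<inter> \<Inter>F \<subseteq> U"
      using bspec[OF loc x] by (elim exE conjE)
    then show "x \<in> (\<Union>F\<in>I. \<Omega> \<inter> \<Inter>F)"
      using x \<open>U \<subseteq> \<Omega>\<close> by (intro UN_I[of F]) (auto simp: I_def)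
  qed (auto simp: I_def)
  moreover have "\<Omega> \<inter> \<Inter>F \<in> sigma_sets \<Omega> T" if "F \<in> I" for F
  proof -
    interpret sigma_algebra \<Omega> "sigma_sets \<Omega> T"
      by (rule sigma_algebra_sigma_sets) (use sub in auto)
    from that have "finite F" "F \<subseteq> T" by (auto simp: I_def)
    then show ?thesis
    proof (induction F)
      case (insert S F)
      then have "S \<inter> (\<Omega> \<inter> \<Inter>F) \<in> sigma_sets \<Omega> T"
        using Int[of S "\<Omega> \<inter> \<Inter>F"] by (auto intro: sigma_sets.Basic)
      then show ?case by (simp add: Int_left_commute)
    qed (simp add: top)
  qed
  ultimately show ?thesis
    using \<open>countable I\<close> sigma_sets_UNION[of "(\<lambda>F. \<Omega> \<inter> \<Inter>F) ` I" \<Omega> T] by auto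
qed

text \<open>A maximum rather than a sum: it stays below any function that dominates each piece, so
  pieces may overlap freely. Negative rationals contribute 0, because \<open>ennreal\<close>
  truncates them.\<close>

definition max_step :: "('a set \<times> rat) set \<Rightarrow> 'a \<Rightarrow> ennreal" where
  "max_step F x = (SUP (B, q)\<in>F. ennreal (of_rat q) * indicator B x)"

lemma max_step_measurable:
  assumes "countable F" "\<And>B q. (B, q) \<in> F \<Longrightarrow> open B"
  shows "max_step F \<in> borel_measurable borel"
  unfolding max_step_def using assms
  by (auto intro!: borel_measurable_SUP borel_measurable_times_ennreal borel_measurable_indicator split: prod.split)

lemma max_step_mono: "F \<subseteq> G \<Longrightarrow> max_step F x \<le> max_step G x"
  unfolding max_step_def by (rule SUP_subset_mono) auto

text \<open>The hypothesis on \<open>w\<close> is lower semicontinuity. If a rational lies below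
  \<open>w x\<close>, it lies below \<open>w\<close> on a basic neighbourhood of \<open>x\<close>;
  so the countably many basic pieces under \<open>w\<close> have supremum \<open>w\<close>.\<close>

lemma max_step_approx:
  fixes w :: "'a::topological_space \<Rightarrow> ennreal"
  assumes \<B>: "topological_basis \<B>" "countable \<B>"
    and w: "\<And>t. open {x. t < w x}"
  obtains F where "\<And>n. finite (F n)" "\<And>n. F n \<subseteq> \<B> \<times> UNIV" "incseq F"
    "\<And>x. (SUP n. max_step (F n) x) = w x"
proof -
  define C where "C = {(B, q). B \<in> \<B> \<and> (\<forall>x\<in>B. ennreal (of_rat q) \<le> w x)}"
  have "countable (\<B> \<times> (UNIV :: rat set))"
    using \<B>(2) by auto
  then have C: "countable C"
    by (rule countable_subset[rotated]) (auto simp: C_def)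
  \<comment> \<open>The first \<open>n\<close> pieces in an enumeration of \<open>C\<close>.
    Intersecting with \<open>C\<close> keeps the values of \<open>from_nat_into\<close> inside
    \<open>C\<close> without a proof that \<open>C\<close> is nonempty.\<close>
  define F where "F n = C \<inter> from_nat_into C ` {..<n}" for n
  have F_Un: "(\<Union>n. F n) = C"
  proof (rule antisym; rule subsetI)
    fix c assume c: "c \<in> C"
    then obtain k where "c = from_nat_into C k"
      using from_nat_into_surj[OF C c] by metis
    then have "c \<in> F (Suc k)"
      using c by (auto simp: F_def)
    then show "c \<in> (\<Union>n. F n)" by blast
  qed (auto simp: F_def)
  show thesis
  proof (rule that[of F])
    show "finite (F n)" "F n \<subseteq> \<B> \<times> UNIV" for n
      by (auto simp: F_def C_def)
    show "incseq F"
      by (auto simp: incseq_def F_def)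
    fix x
    have "(SUP n. max_step (F n) x) = max_step (\<Union>n. F n) x"
      unfolding max_step_def by (rule SUP_UNION[symmetric])
    also have "\<dots> = max_step C x"
      by (simp add: F_Un)
    also have "\<dots> = w x"
    proof (rule antisym)
      show "max_step C x \<le> w x"
        unfolding max_step_def by (auto intro!: SUP_least simp: C_def indicator_def)
      show "w x \<le> max_step C x"
      proof (rule dense_le)
        fix t assume "t < w x"
        then obtain s where s: "t < s" "s < w x"
          using dense by blast
        obtain q where q: "t < ennreal (of_rat q)" "ennreal (of_rat q) < s"
        proof -
          obtain a b where ab: "t = ennreal a" "0 \<le> a" "a < b" "ennreal b \<le> s"
          proof -
            obtain v where "t < v" "v < s" using dense[OF s(1)] by blast
            then show thesis
              by (intro that[of "enn2real t" "enn2real v"]; cases t; cases v)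
                (auto simp: top_unique ennreal_less_iff)
          qed
          obtain q where "a < of_rat q" "of_rat q < b"
            using of_rat_dense[OF ab(3)] by blast
          moreover have "ennreal (of_rat q) < ennreal b"
            using ab \<open>a < of_rat q\<close> \<open>of_rat q < b\<close> by (intro ennreal_lessI) auto
          ultimately show thesis
            using ab by (intro that[of q]) (auto simp: ennreal_less_iff)
        qed
        obtain B where B: "B \<in> \<B>" "x \<in> B" "B \<subseteq> {x. ennreal (of_rat q) < w x}"
          using topological_basisE[OF \<B>(1) w, of x "ennreal (of_rat q)"] less_trans[OF q(2) s(2)]
          by (metis mem_Collect_eq)
        then have "(B, q) \<in> C"
          by (auto simp: C_def intro: less_imp_le)
        then have "ennreal (of_rat q) * indicator B x \<le> max_step C x"
          unfolding max_step_def by (intro SUP_upper2[of "(B, q)"]) auto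
        then show "t \<le> max_step C x"
          using q B by simp
      qed
    qed
    finally show "(SUP n. max_step (F n) x) = w x" .
  qed
qed

text \<open>
  Integrals of the countably many \<^const>\<open>max_step\<close> functions bound integrals of lower semicontinuous
  functions from below.  The bounds on ball measures serve to pass from a signed \<open>h\<close> to the
  nonnegative \<open>h + M\<close> on a ball that contains the support of \<open>h\<close>.
\<close>

definition subbasic_sets :: "'a::metric_space set set \<Rightarrow> 'a \<Rightarrow> 'a measure set set" where
  "subbasic_sets \<B> x\<^sub>0 =
     (\<lambda>(F, r). {\<mu>. boundedly_finite \<mu> \<and> of_rat r < enn2real (\<integral>\<^sup>+ x. max_step F x \<partial>\<mu>)})
       ` ({F. finite F \<and> F \<subseteq> \<B> \<times> UNIV} \<times> UNIV)
     \<union> (\<lambda>(k, M, r). {\<mu>. boundedly_finite \<mu> \<and> real M * measure \<mu> (ball x\<^sub>0 (real k)) < of_rat r}) ` UNIV"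

lemma countable_subbasic_sets:
  assumes "countable \<B>"
  shows "countable (subbasic_sets \<B> x\<^sub>0)"
proof -
  have "countable {F. finite F \<and> F \<subseteq> \<B> \<times> (UNIV :: rat set)}"
    using assms by (intro countable_Collect_finite_subset countable_SIGMA) auto
  then show ?thesis
    unfolding subbasic_sets_def by (intro countable_Un countable_image countable_SIGMA) auto
qed

text \<open>A lower bound for the integral of \<open>v\<close>, combined with an upper bound for the
  mass of the ball, yields a lower bound for the integral of \<open>h\<close>. Upper bounds come
  from the same statement for the negated function.\<close>

lemma subbasic_lower_bound:
  fixes h :: "'a::metric_space \<Rightarrow> real"
  assumes \<B>: "topological_basis \<B>" "countable \<B>"
    and h: "continuous_on UNIV h" "bounded (range h)" "bounded {x. h x \<noteq> 0}"
    and \<mu>: "boundedly_finite \<mu>" and a: "a < integral\<^sup>L \<mu> h"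
  obtains F where "finite F" "F \<subseteq> subbasic_sets \<B> x\<^sub>0" "\<mu> \<in> \<Inter>F"
    "\<forall>\<mu>'. boundedly_finite \<mu>' \<longrightarrow> \<mu>' \<in> \<Inter>F \<longrightarrow> a < integral\<^sup>L \<mu>' h"
proof -
  obtain k :: nat where k: "{x. h x \<noteq> 0} \<subseteq> ball x\<^sub>0 (real k)"
  proof -
    obtain r where r: "{x. h x \<noteq> 0} \<subseteq> ball x\<^sub>0 r"
      using h(3) bounded_subset_ballD by blast
    obtain k :: nat where "r \<le> real k"
      using real_arch_simple by blast
    then show thesis
      using r subset_ball[of r "real k" x\<^sub>0] by (intro that[of k]) auto
  qed
  obtain M :: nat where M: "\<And>x. \<bar>h x\<bar> \<le> real M"
  proof -
    obtain b where b: "\<And>x. \<bar>h x\<bar> \<le> b"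
      using h(2) by (auto simp: bounded_iff)
    obtain M :: nat where "b \<le> real M"
      using real_arch_simple by blast
    then show thesis
      using b by (intro that[of M]) (rule order_trans)
  qed
  let ?b = "ball x\<^sub>0 (real k)"
  define v where "v x = h x + real M * indicator ?b x" for x
  define w where "w x = ennreal (v x)" for x
  have hm: "h \<in> borel_measurable borel"
    by (rule borel_measurable_continuous_onI[OF h(1)])
  have v_nonneg: "0 \<le> v x" for x
    using M[of x] k by (cases "h x = 0"; cases "x \<in> ?b") (auto simp: v_def)
  have w_open: "open {x. t < w x}" for t
  proof -
    \<comment> \<open>Although \<open>v\<close> jumps at the boundary of the ball, it is lower
      semicontinuous: it vanishes outside the ball, since \<open>h\<close> does, and inside it
      equals the continuous function \<open>h + M\<close>.\<close>
    have "{x. t < w x} = {x. t < ennreal (h x + real M)} \<inter> ?b"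
    proof (intro set_eqI)
      fix x
      show "x \<in> {x. t < w x} \<longleftrightarrow> x \<in> {x. t < ennreal (h x + real M)} \<inter> ?b"
        using k by (cases "h x = 0"; cases "x \<in> ?b") (auto simp: w_def v_def)
    qed
    moreover have "open {x. t < ennreal (h x + real M)}"
      by (intro open_Collect_less continuous_on_const continuous_on_ennreal continuous_on_add h(1))
    ultimately show ?thesis by (simp add: open_Int del: Collect_mem_eq)
  qed
  have w_int: "(\<integral>\<^sup>+ x. w x \<partial>\<mu>') = ennreal (integral\<^sup>L \<mu>' h + real M * measure \<mu>' ?b)"
    "0 \<le> integral\<^sup>L \<mu>' h + real M * measure \<mu>' ?b" if \<mu>': "boundedly_finite \<mu>'" for \<mu>'
  proof -
    note s = boundedly_finiteD(1,2)[OF \<mu>']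
    have hi: "integrable \<mu>' h"
      by (rule integrable_boundedly_finite[OF \<mu>' hm h(2,3)])
    have bi: "integrable \<mu>' (\<lambda>x. real M * indicator ?b x)"
      using boundedly_finiteD(3)[OF \<mu>', of ?b] s by (intro integrable_mult_right integrable_real_indicator) auto
    have "integral\<^sup>L \<mu>' v = integral\<^sup>L \<mu>' h + real M * measure \<mu>' ?b"
      unfolding v_def using hi bi s by simp
    moreover have "(\<integral>\<^sup>+ x. w x \<partial>\<mu>') = ennreal (integral\<^sup>L \<mu>' v)"
      unfolding w_def
      by (rule nn_integral_eq_integral) (use hi bi v_nonneg in \<open>auto simp: v_def[abs_def]\<close>)
    moreover have "0 \<le> integral\<^sup>L \<mu>' v"
      by (intro integral_nonneg_AE) (simp add: v_nonneg)
    ultimately show "(\<integral>\<^sup>+ x. w x \<partial>\<mu>') = ennreal (integral\<^sup>L \<mu>' h + real M * measure \<mu>' ?b)"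
      "0 \<le> integral\<^sup>L \<mu>' h + real M * measure \<mu>' ?b" by simp_all
  qed
  obtain F where F: "\<And>n. finite (F n)" "\<And>n. F n \<subseteq> \<B> \<times> UNIV" "incseq F"
    "\<And>x. (SUP n. max_step (F n) x) = w x"
    using max_step_approx[OF \<B> w_open] by metis
  have Fm: "max_step (F n) \<in> borel_measurable borel" for n
    using F(1,2)[of n] topological_basis_open[OF \<B>(1)]
    by (intro max_step_measurable) (auto intro: countable_finite)
  have Fw: "max_step (F n) x \<le> w x" for n x
    unfolding F(4)[symmetric] by (rule SUP_upper) simp
  \<comment> \<open>Half of the gap between \<open>a\<close> and the integral is lost in
    \<open>r1\<close>, below the integral of \<open>w\<close>, and half in \<open>r2\<close>, above
    the mass of the ball: \<open>r1 - r2\<close> exceeds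
    \<open>integral\<^sup>L \<mu> h - 2 * e\<close>, which is \<open>a\<close>.\<close>
  define e where "e = (integral\<^sup>L \<mu> h - a) / 2"
  have e: "0 < e" using a by (simp add: e_def)
  let ?m = "real M * measure \<mu> ?b"
  obtain r1 where r1: "integral\<^sup>L \<mu> h + ?m - e < of_rat r1" "of_rat r1 < integral\<^sup>L \<mu> h + ?m"
    using of_rat_dense[of "integral\<^sup>L \<mu> h + ?m - e" "integral\<^sup>L \<mu> h + ?m"] e by auto
  obtain r2 where r2: "?m < of_rat r2" "of_rat r2 < ?m + e"
    using of_rat_dense[of ?m "?m + e"] e by auto
  have "(\<lambda>n. \<integral>\<^sup>+ x. max_step (F n) x \<partial>\<mu>) \<longlonglongrightarrow> (\<integral>\<^sup>+ x. w x \<partial>\<mu>)"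
  proof (rule tendsto_nn_integral_SUP)
    show "incseq (\<lambda>n. max_step (F n))"
      using F(3) by (auto simp: incseq_def le_fun_def intro: max_step_mono)
    show "max_step (F n) \<in> borel_measurable \<mu>" for n
      using Fm unfolding measurable_cong_sets[OF boundedly_finiteD(1)[OF \<mu>] refl] .
  qed (rule F(4))
  then have "(\<lambda>n. enn2real (\<integral>\<^sup>+ x. max_step (F n) x \<partial>\<mu>)) \<longlonglongrightarrow> integral\<^sup>L \<mu> h + ?m"
    unfolding w_int(1)[OF \<mu>] by (intro tendsto_enn2real w_int(2)[OF \<mu>])
  from order_tendstoD(1)[OF this r1(2)] obtain n where
    n: "of_rat r1 < enn2real (\<integral>\<^sup>+ x. max_step (F n) x \<partial>\<mu>)"
    by (auto simp: eventually_sequentially)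
  let ?S = "{\<mu>. boundedly_finite \<mu> \<and> of_rat r1 < enn2real (\<integral>\<^sup>+ x. max_step (F n) x \<partial>\<mu>)}"
  let ?T = "{\<mu>. boundedly_finite \<mu> \<and> real M * measure \<mu> ?b < of_rat r2}"
  show thesis
  proof (rule that[of "{?S, ?T}"])
    have "?S \<in> subbasic_sets \<B> x\<^sub>0"
      unfolding subbasic_sets_def using F(1,2) by (intro UnI1 image_eqI[of _ _ "(F n, r1)"]) auto
    moreover have "?T \<in> subbasic_sets \<B> x\<^sub>0"
      unfolding subbasic_sets_def by (intro UnI2 image_eqI[of _ _ "(k, M, r2)"]) auto
    ultimately show "{?S, ?T} \<subseteq> subbasic_sets \<B> x\<^sub>0" by blast
    show "\<mu> \<in> \<Inter>{?S, ?T}"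
      using \<mu> n r2 by simp
    show "\<forall>\<mu>'. boundedly_finite \<mu>' \<longrightarrow> \<mu>' \<in> \<Inter>{?S, ?T} \<longrightarrow> a < integral\<^sup>L \<mu>' h"
    proof (intro allI impI)
      fix \<mu>' assume \<mu>': "boundedly_finite \<mu>'" and "\<mu>' \<in> \<Inter>{?S, ?T}"
      then have "of_rat r1 < enn2real (\<integral>\<^sup>+ x. max_step (F n) x \<partial>\<mu>')"
        and 2: "real M * measure \<mu>' ?b < of_rat r2" by auto
      note this(1)
      \<comment> \<open>\<open>enn2real\<close> sends infinity to 0 and so is monotone only below a
        finite bound; here the integral of \<open>w\<close> is finite, because \<mu>' is boundedly
        finite.\<close>
      also have "enn2real (\<integral>\<^sup>+ x. max_step (F n) x \<partial>\<mu>') \<le> enn2real (\<integral>\<^sup>+ x. w x \<partial>\<mu>')"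
        by (intro enn2real_mono nn_integral_mono Fw) (simp add: w_int(1)[OF \<mu>'])
      also have "\<dots> = integral\<^sup>L \<mu>' h + real M * measure \<mu>' ?b"
        unfolding w_int(1)[OF \<mu>'] using w_int(2)[OF \<mu>'] by (rule enn2real_ennreal)
      finally show "a < integral\<^sup>L \<mu>' h"
        using 2 r1(1) r2(2) by (simp add: e_def field_simps)
    qed
  qed simp
qed

definition evaluation_sets :: "'a::metric_space measure set set" where
  "evaluation_sets = {{\<mu>. boundedly_finite \<mu> \<and> emeasure \<mu> A \<in> B} | A B.
     A \<in> sets borel \<and> bounded A \<and> B \<in> sets borel}"

text \<open>Second countability enters through the countable basis of open sets, which makes the
  family of test sets countable. For the inclusion of open sets it then suffices that the tests are
  measurable for the evaluations and refine the subbasis.\<close>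

lemma sets_bfm_space_eq_evaluation_sets:
  "sets bfm_space = sigma_sets {\<mu>. boundedly_finite \<mu>}
     (evaluation_sets :: 'a::{metric_space, second_countable_topology} measure set set)"
    (is "_ = sigma_sets ?\<Omega> _")
proof (rule antisym)
  define E where "E = sigma ?\<Omega> (evaluation_sets :: 'a measure set set)"
  have sub: "(evaluation_sets :: 'a measure set set) \<subseteq> Pow ?\<Omega>"
    by (auto simp: evaluation_sets_def)
  have sets_E: "sets E = sigma_sets ?\<Omega> evaluation_sets" and space_E: "space E = ?\<Omega>"
    unfolding E_def using sub by (auto simp: sets_measure_of space_measure_of)
  have eval: "(\<lambda>\<mu>. emeasure \<mu> A) \<in> borel_measurable E" if "A \<in> sets borel" "bounded A" for A :: "'a set"
  proof (rule measurableI)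
    fix B :: "ennreal set" assume "B \<in> sets borel"
    then have "{\<mu>. boundedly_finite \<mu> \<and> emeasure \<mu> A \<in> B} \<in> sets E"
      unfolding sets_E using that by (intro sigma_sets.Basic) (auto simp: evaluation_sets_def)
    also have "{\<mu>. boundedly_finite \<mu> \<and> emeasure \<mu> A \<in> B} = (\<lambda>\<mu>. emeasure \<mu> A) -` B \<inter> space E"
      by (auto simp: space_E)
    finally show "(\<lambda>\<mu>. emeasure \<mu> A) -` B \<inter> space E \<in> sets E" .
  qed simp
  have nn_eval: "(\<lambda>\<mu>. \<integral>\<^sup>+ x. u x \<partial>\<mu>) \<in> borel_measurable E"
    if "u \<in> borel_measurable borel" for u :: "'a \<Rightarrow> ennreal"
    by (rule measurable_nn_integral_of_bounded_sets[OF _ eval that])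
      (auto simp: space_E boundedly_finiteD)
  obtain \<B> :: "'a set set" where \<B>: "topological_basis \<B>" "countable \<B>"
    using ex_countable_basis by blast
  let ?T = "subbasic_sets \<B> (undefined :: 'a)"
  have T1: "{\<mu>. boundedly_finite \<mu> \<and> of_rat r < enn2real (\<integral>\<^sup>+ x. max_step F x \<partial>\<mu>)}
      \<in> sigma_sets ?\<Omega> evaluation_sets" if F: "finite F" "F \<subseteq> \<B> \<times> UNIV" for F r
  proof -
    have [measurable]: "(\<lambda>\<mu>. \<integral>\<^sup>+ x. max_step F x \<partial>\<mu>) \<in> borel_measurable E"
      using F topological_basis_open[OF \<B>(1)]
      by (intro nn_eval max_step_measurable) (auto intro: countable_finite)
    have "{\<mu>\<in>space E. of_rat r < enn2real (\<integral>\<^sup>+ x. max_step F x \<partial>\<mu>)} \<in> sets E"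
      by measurable
    then show ?thesis
      by (simp add: sets_E space_E)
  qed
  have T2: "{\<mu> :: 'a measure. boundedly_finite \<mu> \<and> real M * measure \<mu> (ball undefined (real k)) < of_rat r}
      \<in> sigma_sets ?\<Omega> evaluation_sets" for k M r
  proof -
    have [measurable]: "(\<lambda>\<mu> :: 'a measure. emeasure \<mu> (ball undefined (real k))) \<in> borel_measurable E"
      by (intro eval) auto
    have "{\<mu>\<in>space E. real M * measure \<mu> (ball undefined (real k)) < of_rat r} \<in> sets E"
      unfolding measure_def by measurable
    then show ?thesis
      by (simp add: sets_E space_E)
  qed
  have T_sub: "?T \<subseteq> sigma_sets ?\<Omega> evaluation_sets"
    unfolding subbasic_sets_def by (intro Un_least image_subsetI) (auto intro: T1 T2)
  have "U \<in> sigma_sets ?\<Omega> ?T" if "openin weak_hash_topology U" for U :: "'a measure set"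
    using that unfolding weak_hash_topology_def
  proof (rule openin_topology_generated_by_countable)
    show "countable ?T"
      by (rule countable_subbasic_sets[OF \<B>(2)])
    show "\<Union>?T \<subseteq> ?\<Omega>"
      by (auto simp: subbasic_sets_def)
    fix S and \<mu> :: "'a measure"
    assume "S \<in> {{\<mu>. boundedly_finite \<mu> \<and> integral\<^sup>L \<mu> h \<in> U} | (h :: 'a \<Rightarrow> real) U.
        continuous_on UNIV h \<and> bounded (range h) \<and> bounded {x. h x \<noteq> 0} \<and> open U}"
    then obtain h :: "'a \<Rightarrow> real" and V where S: "S = {\<mu>. boundedly_finite \<mu> \<and> integral\<^sup>L \<mu> h \<in> V}"
      and h: "continuous_on UNIV h" "bounded (range h)" "bounded {x. h x \<noteq> 0}" and V: "open V"
      by blast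
    assume "\<mu> \<in> S"
    then have \<mu>: "boundedly_finite \<mu>" and "integral\<^sup>L \<mu> h \<in> V"
      by (auto simp: S)
    obtain e where e: "0 < e" "ball (integral\<^sup>L \<mu> h) e \<subseteq> V"
      using openE[OF V \<open>integral\<^sup>L \<mu> h \<in> V\<close>] .
    \<comment> \<open>A two-sided estimate of the integral of \<open>h\<close> is obtained from
      lower bounds for \<open>h\<close> and for its negative.\<close>
    have lt: "integral\<^sup>L \<mu> h - e < integral\<^sup>L \<mu> h"
      "- integral\<^sup>L \<mu> h - e < integral\<^sup>L \<mu> (\<lambda>x. - h x)"
      using e(1) by simp_all
    obtain F where F: "finite F" "F \<subseteq> ?T" "\<mu> \<in> \<Inter>F"
      "\<forall>\<mu>'. boundedly_finite \<mu>' \<longrightarrow> \<mu>' \<in> \<Inter>F \<longrightarrow> integral\<^sup>L \<mu> h - e < integral\<^sup>L \<mu>' h"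
      using subbasic_lower_bound[OF \<B> h \<mu> lt(1), where x\<^sub>0 = undefined] .
    have neg: "continuous_on UNIV (\<lambda>x. - h x)" "bounded (range (\<lambda>x. - h x))" "bounded {x. - h x \<noteq> 0}"
      using h by (auto intro: continuous_intros simp: bounded_iff)
    obtain G where G: "finite G" "G \<subseteq> ?T" "\<mu> \<in> \<Inter>G"
      "\<forall>\<mu>'. boundedly_finite \<mu>' \<longrightarrow> \<mu>' \<in> \<Inter>G \<longrightarrow> - integral\<^sup>L \<mu> h - e < integral\<^sup>L \<mu>' (\<lambda>x. - h x)"
      using subbasic_lower_bound[OF \<B> neg \<mu> lt(2), where x\<^sub>0 = undefined] .
    show "\<exists>F. finite F \<and> F \<subseteq> ?T \<and> \<mu> \<in> \<Inter>F \<and> ?\<Omega> \<inter> \<Inter>F \<subseteq> S"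
    proof (intro exI[of _ "F \<union> G"] conjI subsetI)
      fix \<mu>' assume "\<mu>' \<in> ?\<Omega> \<inter> \<Inter>(F \<union> G)"
      then have bf: "boundedly_finite \<mu>'" and "\<mu>' \<in> \<Inter>F" "\<mu>' \<in> \<Inter>G" by auto
      then have "integral\<^sup>L \<mu>' h \<in> ball (integral\<^sup>L \<mu> h) e"
        using F(4)[rule_format, of \<mu>'] G(4)[rule_format, of \<mu>'] by (simp add: dist_real_def)
      then show "\<mu>' \<in> S"
        using e(2) bf by (auto simp: S)
    qed (use F G in auto)
  qed auto
  then show "sets bfm_space \<subseteq> sigma_sets ?\<Omega> (evaluation_sets :: 'a measure set set)"
    unfolding sets_bfm_space using T_sub
    by (intro sigma_sets_mono) (auto intro: sigma_sets_mono[THEN subsetD, of ?T])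
  show "sigma_sets ?\<Omega> evaluation_sets \<subseteq> sets (bfm_space :: 'a measure measure)"
    unfolding sets_bfm_space
  proof (rule sigma_sets_mono, rule subsetI, unfold sets_bfm_space[symmetric])
    fix S :: "'a measure set" assume "S \<in> evaluation_sets"
    then obtain A B where S: "S = {\<mu>. boundedly_finite \<mu> \<and> emeasure \<mu> A \<in> B}"
        and AB: "A \<in> sets borel" "bounded A" "B \<in> sets borel"
      by (auto simp: evaluation_sets_def)
    have "(\<lambda>\<mu>. emeasure \<mu> A) -` B \<inter> space bfm_space \<in> sets bfm_space"
      by (rule measurable_sets[OF measurable_emeasure_bfm_space[OF AB(1,2)] AB(3)])
    also have "(\<lambda>\<mu>. emeasure \<mu> A) -` B \<inter> space bfm_space = S"
      by (auto simp: S space_bfm_space)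
    finally show "S \<in> sets bfm_space" .
  qed
qed

section \<open>The Laplace functional of a Poisson random measure\<close>

text \<open>Minus the logarithm of the Laplace functional of a Poisson random measure with mean
  \<nu>. As the integrand is at most 1, infinite values of \<open>u\<close> do no harm.\<close>

definition laplace_exponent :: "('a \<Rightarrow> ennreal) \<Rightarrow> 'a measure \<Rightarrow> ennreal" where
  "laplace_exponent u \<nu> = (\<integral>\<^sup>+ x. 1 - exp_neg (u x) \<partial>\<nu>)"

lemma poisson_random_measureD:
  assumes "poisson_random_measure \<Omega> \<nu> N"
  shows "prob_space \<Omega>" "N \<in> measurable \<Omega> bfm_space"
    and "\<And>\<omega>. \<omega> \<in> space \<Omega> \<Longrightarrow> boundedly_finite (N \<omega>)"
    and "\<And>A k. A \<in> sets borel \<Longrightarrow> bounded A \<Longrightarrow>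
           measure \<Omega> {\<omega>\<in>space \<Omega>. emeasure (N \<omega>) A = of_nat k}
             = measure \<nu> A ^ k / fact k * exp (- measure \<nu> A)"
    and "\<And>(n :: nat) A. \<forall>i<n. A i \<in> sets borel \<and> bounded (A i) \<Longrightarrow>
           disjoint_family_on A {..<n} \<Longrightarrow>
           prob_space.indep_vars \<Omega> (\<lambda>_. borel) (\<lambda>i \<omega>. emeasure (N \<omega>) (A i)) {..<n}"
  using assms measurable_space[of N \<Omega> bfm_space]
  unfolding poisson_random_measure_def space_bfm_space by auto

lemma poisson_emeasure_measurable:
  assumes "poisson_random_measure \<Omega> \<nu> N" "A \<in> sets borel" "bounded A"
  shows "(\<lambda>\<omega>. emeasure (N \<omega>) A) \<in> borel_measurable \<Omega>"
  using measurable_compose[OF poisson_random_measureD(2)[OF assms(1)]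
      measurable_emeasure_bfm_space[OF assms(2,3)]] .

text \<open>This is the generating function of the Poisson law, evaluated at exp (- y).\<close>

lemma nn_integral_exp_neg_poisson_set:
  fixes \<nu> :: "'a::metric_space measure"
  assumes N: "poisson_random_measure \<Omega> \<nu> N" and \<nu>: "boundedly_finite \<nu>"
    and A: "A \<in> sets borel" "bounded A" and y: "y < \<top>"
  shows "(\<integral>\<^sup>+ \<omega>. exp_neg (y * emeasure (N \<omega>) A) \<partial>\<Omega>) = exp_neg ((1 - exp_neg y) * emeasure \<nu> A)"
proof -
  note [measurable] = poisson_emeasure_measurable[OF N A]
  interpret prob_space \<Omega> by (rule poisson_random_measureD[OF N])
  define l where "l = measure \<nu> A"
  define E where "E k = {\<omega>\<in>space \<Omega>. emeasure (N \<omega>) A = of_nat k}" for k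
  have E [measurable]: "E k \<in> sets \<Omega>" for k
    unfolding E_def by measurable
  have pE: "measure \<Omega> (E k) = l ^ k / fact k * exp (- l)" for k
    using poisson_random_measureD(4)[OF N A] unfolding E_def l_def .
  \<comment> \<open>Needed twice: \<open>c = 1\<close> gives the total mass of the Poisson weights,
    and \<open>c = exp (- r)\<close> gives the Laplace transform.\<close>
  have exp_sums: "(\<lambda>k. c ^ k * (l ^ k / fact k * exp (- l))) sums exp (- ((1 - c) * l))" for c
  proof -
    have "(\<lambda>k. (c * l) ^ k /\<^sub>R fact k * exp (- l)) sums (exp (c * l) * exp (- l))"
      by (intro sums_mult2 exp_converges)
    then show ?thesis
      by (simp add: power_mult_distrib field_simps mult_exp_exp)
  qed
  \<comment> \<open>\<open>N\<close> is given as a random measure with arbitrary values. That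
    \<open>N A\<close> is almost surely a natural number follows because the probabilities of the
    disjoint events \<open>E k\<close> already sum to 1.\<close>
  have disj: "disjoint_family E"
    unfolding disjoint_family_on_def E_def by auto
  have "(\<lambda>k. measure \<Omega> (E k)) sums measure \<Omega> (\<Union>k. E k)"
    by (rule finite_measure_UNION) (use disj E in auto)
  moreover have "(\<lambda>k. measure \<Omega> (E k)) sums 1"
    using exp_sums[of 1] by (simp add: pE)
  ultimately have "prob (\<Union>k. E k) = 1"
    by (rule sums_unique2)
  then have AE_E: "AE \<omega> in \<Omega>. \<omega> \<in> (\<Union>k. E k)"
    by (subst (asm) prob_eq_1) auto
  obtain r where r: "0 \<le> r" "y = ennreal r"
    using y by (cases y) auto
  have "AE \<omega> in \<Omega>. exp_neg (y * emeasure (N \<omega>) A) = (\<Sum>k. exp_neg y ^ k * indicator (E k) \<omega>)"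
    using AE_E
  proof eventually_elim
    case (elim \<omega>)
    then obtain k where k: "\<omega> \<in> E k" by auto
    then have "\<omega> \<in> E j \<longleftrightarrow> j = k" for j
      using disj by (auto simp: disjoint_family_on_def)
    then have "(\<lambda>j. exp_neg y ^ j * indicator (E j) \<omega>) = (\<lambda>j. if j = k then exp_neg y ^ j else 0)"
      by (auto simp: indicator_def)
    then have "(\<lambda>j. exp_neg y ^ j * indicator (E j) \<omega>) sums exp_neg y ^ k"
      using sums_single[of k "\<lambda>j. exp_neg y ^ j"] by simp
    moreover have "exp_neg (y * emeasure (N \<omega>) A) = exp_neg y ^ k"
      using k by (simp add: E_def exp_neg_of_nat_mult mult.commute[of y])
    ultimately show ?case by (simp add: sums_iff)
  qed
  then have "(\<integral>\<^sup>+ \<omega>. exp_neg (y * emeasure (N \<omega>) A) \<partial>\<Omega>)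
      = (\<integral>\<^sup>+ \<omega>. (\<Sum>k. exp_neg y ^ k * indicator (E k) \<omega>) \<partial>\<Omega>)"
    by (rule nn_integral_cong_AE)
  also have "\<dots> = (\<Sum>k. exp_neg y ^ k * emeasure \<Omega> (E k))"
    by (subst nn_integral_suminf) (auto simp: nn_integral_cmult_indicator)
  also have "\<dots> = (\<Sum>k. ennreal (exp (- r) ^ k * (l ^ k / fact k * exp (- l))))"
    using r by (intro suminf_cong)
      (simp add: exp_neg_ennreal emeasure_eq_measure pE l_def ennreal_power flip: ennreal_mult)
  also have "\<dots> = ennreal (exp (- ((1 - exp (- r)) * l)))"
    by (rule suminf_ennreal_eq[OF _ exp_sums]) (simp add: l_def)
  also have "\<dots> = exp_neg ((1 - exp_neg y) * emeasure \<nu> A)"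
  proof -
    have "emeasure \<nu> A = ennreal l"
      using boundedly_finiteD(3)[OF \<nu> A] by (simp add: l_def emeasure_eq_ennreal_measure)
    moreover have "1 - exp_neg y = ennreal (1 - exp (- r))"
      using r by (simp add: exp_neg_ennreal ennreal_minus flip: ennreal_1)
    ultimately show ?thesis
      using r by (simp add: exp_neg_ennreal l_def flip: ennreal_mult)
  qed
  finally show ?thesis .
qed

lemma nn_integral_exp_neg_poisson_simple:
  fixes \<nu> :: "'a::metric_space measure"
  assumes N: "poisson_random_measure \<Omega> \<nu> N" and \<nu>: "boundedly_finite \<nu>"
    and u: "simple_function borel u" "\<And>x. u x < \<top>" "bounded {x. u x \<noteq> 0}"
  shows "(\<integral>\<^sup>+ \<omega>. exp_neg (\<integral>\<^sup>+ x. u x \<partial>N \<omega>) \<partial>\<Omega>) = exp_neg (laplace_exponent u \<nu>)"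
proof -
  interpret prob_space \<Omega> by (rule poisson_random_measureD[OF N])
  have [measurable]: "u \<in> borel_measurable borel"
    using u(1) by (rule borel_measurable_simple_function)
  have "finite (range u - {0})"
    using u(1) by (simp add: simple_function_def)
  \<comment> \<open>The value 0 is left out: its level set is usually unbounded, while the other
    level sets lie in the bounded support, where the Poisson conditions apply. Indices are naturals
    below \<open>n\<close>, as in the independence condition.\<close>
  then obtain n :: nat and y where y: "bij_betw y {..<n} (range u - {0})"
    using ex_bij_betw_nat_finite atLeast0LessThan by metis
  define A where "A i = {x. u x = y i}" for i
  have y_pos: "y i \<noteq> 0" "y i < \<top>" if "i < n" for i
  proof -
    have "y i \<in> range u - {0}"
      using bij_betwE[OF y] that by simp
    then obtain x where "y i = u x" "y i \<noteq> 0" by auto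
    then show "y i \<noteq> 0" "y i < \<top>" using u(2)[of x] by auto
  qed
  have A: "A i \<in> sets borel" "bounded (A i)" if "i < n" for i
  proof -
    show "A i \<in> sets borel"
      unfolding A_def by measurable
    show "bounded (A i)"
      using u(3) by (rule bounded_subset) (use y_pos(1)[OF that] in \<open>auto simp: A_def\<close>)
  qed
  have disj: "disjoint_family_on A {..<n}"
    using y by (auto simp: disjoint_family_on_def A_def bij_betw_def inj_on_def)
  \<comment> \<open>A general \<open>g\<close> with \<open>g 0 = 0\<close> covers both sides of the
    claim: the identity gives the integral against \<open>N\<close>, and
    \<open>1 - exp_neg t\<close> gives the Laplace exponent.\<close>
  have decomp: "g (u x) = (\<Sum>i<n. g (y i) * indicator (A i) x)" if "g 0 = 0"
    for g :: "ennreal \<Rightarrow> ennreal" and x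
  proof (cases "u x = 0")
    case True
    then show ?thesis
      using that y_pos by (auto simp: A_def indicator_def intro!: sum.neutral[symmetric])
  next
    case False
    then obtain j where j: "j < n" "u x = y j"
      using bij_betw_imp_surj_on[OF y] by (auto simp: set_eq_iff image_iff)
    have "(\<Sum>i<n. g (y i) * indicator (A i) x) = (\<Sum>i<n. if i = j then g (y i) else 0)"
    proof (rule sum.cong)
      fix i assume "i \<in> {..<n}"
      then show "g (y i) * indicator (A i) x = (if i = j then g (y i) else 0)"
        using j y by (auto simp: A_def indicator_def bij_betw_def inj_on_def)
    qed simp
    then show ?thesis using j by simp
  qed
  have int: "(\<integral>\<^sup>+ x. g (u x) \<partial>\<mu>) = (\<Sum>i<n. g (y i) * emeasure \<mu> (A i))"
    if "g 0 = 0" "sets \<mu> = sets borel" for g :: "ennreal \<Rightarrow> ennreal" and \<mu> :: "'a measure"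
    unfolding decomp[of g, OF that(1)] using A that(2)
    by (subst nn_integral_sum) (auto simp: nn_integral_cmult_indicator intro!: borel_measurable_times_ennreal)
  have indep: "indep_vars (\<lambda>_. borel) (\<lambda>i \<omega>. exp_neg (y i * emeasure (N \<omega>) (A i))) {..<n}"
    using A by (intro indep_vars_compose2[OF poisson_random_measureD(5)[OF N _ disj]]) auto
  have "(\<integral>\<^sup>+ \<omega>. exp_neg (\<integral>\<^sup>+ x. u x \<partial>N \<omega>) \<partial>\<Omega>)
      = (\<integral>\<^sup>+ \<omega>. (\<Prod>i<n. exp_neg (y i * emeasure (N \<omega>) (A i))) \<partial>\<Omega>)"
  proof (rule nn_integral_cong)
    fix \<omega> assume "\<omega> \<in> space \<Omega>"
    then have "sets (N \<omega>) = sets borel"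
      by (intro boundedly_finiteD poisson_random_measureD[OF N])
    then show "exp_neg (\<integral>\<^sup>+ x. u x \<partial>N \<omega>) = (\<Prod>i<n. exp_neg (y i * emeasure (N \<omega>) (A i)))"
      using int[of "\<lambda>t. t" "N \<omega>"] by (simp add: exp_neg_sum)
  qed
  also have "\<dots> = (\<Prod>i<n. \<integral>\<^sup>+ \<omega>. exp_neg (y i * emeasure (N \<omega>) (A i)) \<partial>\<Omega>)"
    by (rule indep_vars_nn_integral[OF _ indep]) auto
  also have "\<dots> = (\<Prod>i<n. exp_neg ((1 - exp_neg (y i)) * emeasure \<nu> (A i)))"
    by (intro prod.cong nn_integral_exp_neg_poisson_set[OF N \<nu>]) (auto intro: A y_pos)
  also have "\<dots> = exp_neg (laplace_exponent u \<nu>)"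
    unfolding laplace_exponent_def exp_neg_sum[symmetric]
    using int[of "\<lambda>t. 1 - exp_neg t" \<nu>] boundedly_finiteD(1)[OF \<nu>] by simp
  finally show ?thesis .
qed

text \<open>Infinite values of \<open>u\<close> enter only here, as limits of finite simple
  functions.\<close>

lemma nn_integral_exp_neg_poisson:
  fixes \<nu> :: "'a::metric_space measure"
  assumes N: "poisson_random_measure \<Omega> \<nu> N" and \<nu>: "boundedly_finite \<nu>"
    and u: "u \<in> borel_measurable borel" "bounded {x. u x \<noteq> 0}"
  shows "(\<integral>\<^sup>+ \<omega>. exp_neg (\<integral>\<^sup>+ x. u x \<partial>N \<omega>) \<partial>\<Omega>) = exp_neg (laplace_exponent u \<nu>)"
proof -
  interpret prob_space \<Omega> by (rule poisson_random_measureD[OF N])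
  have sets_N: "sets (N \<omega>) = sets borel" if "\<omega> \<in> space \<Omega>" for \<omega>
    using that by (intro boundedly_finiteD poisson_random_measureD[OF N])
  obtain U where U: "\<And>i. simple_function borel (U i)" "incseq U" "\<And>i x. U i x < \<top>"
      "\<And>x. (SUP i. U i x) = u x"
    using borel_measurable_implies_simple_function_sequence'[OF u(1)] by blast
  have [measurable]: "U i \<in> borel_measurable borel" for i
    using U(1) by (rule borel_measurable_simple_function)
  have U_le: "U i x \<le> u x" for i x
    unfolding U(4)[symmetric] by (rule SUP_upper) simp
  have bdd: "bounded {x. U i x \<noteq> 0}" for i
    using u(2) by (rule bounded_subset) (use U_le in \<open>metis (mono_tags) Collect_mono le_zero_eq\<close>)
  have Umeas: "(\<lambda>\<omega>. \<integral>\<^sup>+ x. U i x \<partial>N \<omega>) \<in> borel_measurable \<Omega>" for i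
    by (rule measurable_nn_integral_of_bounded_sets[OF sets_N poisson_emeasure_measurable[OF N]]) auto
  have umeas: "(\<lambda>\<omega>. \<integral>\<^sup>+ x. u x \<partial>N \<omega>) \<in> borel_measurable \<Omega>"
    by (rule measurable_nn_integral_of_bounded_sets[OF sets_N poisson_emeasure_measurable[OF N] u(1)])
  have "(\<lambda>i. \<integral>\<^sup>+ \<omega>. exp_neg (\<integral>\<^sup>+ x. U i x \<partial>N \<omega>) \<partial>\<Omega>)
      \<longlonglongrightarrow> (\<integral>\<^sup>+ \<omega>. exp_neg (\<integral>\<^sup>+ x. u x \<partial>N \<omega>) \<partial>\<Omega>)"
  \<comment> \<open>These integrands decrease as \<open>U i\<close> grows, so monotone convergence
    is replaced by domination by 1 on a probability space.\<close>
  proof (rule nn_integral_dominated_convergence[where w = "\<lambda>_. 1"])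
    show "AE \<omega> in \<Omega>. (\<lambda>i. exp_neg (\<integral>\<^sup>+ x. U i x \<partial>N \<omega>)) \<longlonglongrightarrow> exp_neg (\<integral>\<^sup>+ x. u x \<partial>N \<omega>)"
      by (rule AE_I2, intro tendsto_exp_neg tendsto_nn_integral_SUP)
        (use U in \<open>auto simp: measurable_cong_sets[OF sets_N refl]\<close>)
  qed (use Umeas umeas in \<open>auto simp: exp_neg_le_1 emeasure_space_1\<close>)
  moreover have "(\<lambda>i. exp_neg (laplace_exponent (U i) \<nu>)) \<longlonglongrightarrow> exp_neg (laplace_exponent u \<nu>)"
    unfolding laplace_exponent_def
  proof (intro tendsto_exp_neg nn_integral_LIMSEQ)
    \<comment> \<open>In the exponent the integrands increase, so monotone convergence
      applies.\<close>
    show "incseq (\<lambda>i x. 1 - exp_neg (U i x))"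
      using U(2) by (auto simp: incseq_def le_fun_def intro!: ennreal_minus_mono exp_neg_antimono)
    show "(\<lambda>x. 1 - exp_neg (U i x)) \<in> borel_measurable \<nu>" for i
      unfolding measurable_cong_sets[OF boundedly_finiteD(1)[OF \<nu>] refl] by measurable
    fix x
    have "incseq (\<lambda>i. U i x)"
      using U(2) by (auto simp: incseq_def le_fun_def)
    then have "(\<lambda>i. U i x) \<longlonglongrightarrow> u x"
      using LIMSEQ_SUP[of "\<lambda>i. U i x"] U(4) by simp
    then show "(\<lambda>i. 1 - exp_neg (U i x)) \<longlonglongrightarrow> 1 - exp_neg (u x)"
      by (intro tendsto_diff_ennreal tendsto_exp_neg tendsto_const) (use exp_neg_less_top in \<open>auto simp: less_top\<close>)
  qed
  ultimately show ?thesis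
    using nn_integral_exp_neg_poisson_simple[OF N \<nu> U(1,3) bdd]
    by (simp add: LIMSEQ_unique)
qed

section \<open>Uniqueness from the Laplace functional\<close>

lemma integrable_power_unit_interval:
  fixes M :: "real measure"
  assumes fin: "finite_measure M" and "sets M = sets borel" "AE x in M. x \<in> {0..1}"
  shows "integrable M (\<lambda>x. x ^ k)"
proof (rule finite_measure.integrable_const_bound[OF fin])
  show "AE x in M. norm (x ^ k) \<le> 1"
    using assms(3) by eventually_elim (auto simp: power_le_one)
  show "(\<lambda>x. x ^ k) \<in> borel_measurable M"
    unfolding measurable_cong_sets[OF assms(2) refl] by measurable
qed

text \<open>Indicators of open sets are increasing limits of continuous functions into [0,1], and
  the open sets form an intersection-stable generator that contains the whole space.\<close>

lemma measure_eqI_open_integral: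
  fixes M N :: "'a::metric_space measure"
  assumes fin: "finite_measure M" "finite_measure N"
    and sets: "sets M = sets borel" "sets N = sets borel"
    and eq: "\<And>h :: 'a \<Rightarrow> real. continuous_on UNIV h \<Longrightarrow> (\<And>x. 0 \<le> h x) \<Longrightarrow> (\<And>x. h x \<le> 1) \<Longrightarrow>
      integral\<^sup>L M h = integral\<^sup>L N h"
  shows "M = N"
proof (rule measure_eqI_generator_eq[where E = "{S. open S}" and \<Omega> = UNIV and A = "\<lambda>_. UNIV"])
  show "Int_stable {S :: 'a set. open S}"
    by (auto simp: Int_stable_def)
  show "sets M = sigma_sets UNIV {S. open S}" "sets N = sigma_sets UNIV {S. open S}"
    using sets by (simp_all add: borel_def)
  show "emeasure M UNIV \<noteq> \<infinity>"
    using finite_measure.emeasure_finite[OF fin(1)] by simp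
  fix U :: "'a set" assume "U \<in> {S. open S}"
  then have U: "open U" by simp
  obtain h :: "nat \<Rightarrow> 'a \<Rightarrow> real"
    where h: "\<And>n. continuous_on UNIV (h n)" "\<And>n x. 0 \<le> h n x" "\<And>n x. h n x \<le> 1"
    and inc: "\<And>x. incseq (\<lambda>n. h n x)" and lim: "\<And>x. (\<lambda>n. h n x) \<longlonglongrightarrow> indicator U x"
    using open_indicator_approximation[OF U] by metis
  have lim': "(\<lambda>n. ennreal (integral\<^sup>L K (h n))) \<longlonglongrightarrow> emeasure K U"
    if K: "finite_measure K" "sets K = sets borel" for K
  proof -
    have hm: "h n \<in> borel_measurable K" for n
      using borel_measurable_continuous_onI[OF h(1)] unfolding measurable_cong_sets[OF K(2) refl] .
    have "(\<lambda>n. \<integral>\<^sup>+ x. ennreal (h n x) \<partial>K) \<longlonglongrightarrow> (\<integral>\<^sup>+ x. ennreal (indicator U x) \<partial>K)"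
    proof (rule nn_integral_LIMSEQ)
      show "incseq (\<lambda>n x. ennreal (h n x))"
        using inc by (auto simp: incseq_def le_fun_def intro!: ennreal_leI)
      show "(\<lambda>x. ennreal (h n x)) \<in> borel_measurable K" for n
        using hm[of n] by measurable
    qed (intro tendsto_ennrealI lim)
    moreover have "(\<integral>\<^sup>+ x. ennreal (h n x) \<partial>K) = ennreal (integral\<^sup>L K (h n))" for n
      by (intro nn_integral_eq_integral finite_measure.integrable_const_bound[OF K(1), of _ 1] hm)
        (auto simp: h)
    ultimately show ?thesis
      using U K(2) by (simp add: ennreal_indicator)
  qed
  show "emeasure M U = emeasure N U"
    using lim'[OF fin(1) sets(1)] lim'[OF fin(2) sets(2)] eq[OF h] by (simp add: LIMSEQ_unique)
qed auto

text \<open>By Weierstrass, a continuous function is uniformly close on [0,1] to a polynomial, whose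
  integral is a combination of moments.\<close>

lemma measure_eqI_moments_unit_interval:
  fixes M N :: "real measure"
  assumes fin: "finite_measure M" "finite_measure N"
    and sets: "sets M = sets borel" "sets N = sets borel"
    and supp: "AE x in M. x \<in> {0..1}" "AE x in N. x \<in> {0..1}"
    and moments: "\<And>k. integral\<^sup>L M (\<lambda>x. x ^ k) = integral\<^sup>L N (\<lambda>x. x ^ k)"
  shows "M = N"
proof (rule measure_eqI_open_integral[OF fin sets])
  fix h :: "real \<Rightarrow> real"
  assume h: "continuous_on UNIV h" "\<And>x. 0 \<le> h x" "\<And>x. h x \<le> 1"
  let ?C = "measure M UNIV + measure N UNIV"
  have C: "0 \<le> ?C" by simp
  have "\<bar>integral\<^sup>L M h - integral\<^sup>L N h\<bar> \<le> 0 + e" if "0 < e" for e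
  proof -
    \<comment> \<open>Each measure contributes an error of \<open>d\<close> times its total mass.
      The added 1 keeps the denominator positive when both measures vanish.\<close>
    define d where "d = e / (?C + 1)"
    have d: "0 < d" "d * ?C \<le> e"
      using that C by (auto simp: d_def field_simps add_pos_nonneg)
    obtain p where p: "real_polynomial_function p" "\<And>x. x \<in> {0..1} \<Longrightarrow> \<bar>h x - p x\<bar> < d"
      using Stone_Weierstrass_real_polynomial_function[of "{0..1}" h d] h(1) d(1)
      by (metis compact_Icc continuous_on_subset subset_UNIV)
    then obtain c n where p_eq: "p = (\<lambda>x. \<Sum>i\<le>n. c i * x ^ i)"
      using real_polynomial_function_iff_sum by blast
    have approx: "\<bar>integral\<^sup>L K h - (\<Sum>i\<le>n. c i * integral\<^sup>L K (\<lambda>x. x ^ i))\<bar> \<le> d * measure K UNIV"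
      if K: "finite_measure K" "sets K = sets borel" "AE x in K. x \<in> {0..1}" for K :: "real measure"
    proof -
      interpret finite_measure K by (rule K(1))
      have sp: "space K = UNIV"
        using sets_eq_imp_space_eq[OF K(2)] by simp
      have "h \<in> borel_measurable K"
        using borel_measurable_continuous_onI[OF h(1)] unfolding measurable_cong_sets[OF K(2) refl] .
      then have ih: "integrable K h"
        by (intro integrable_const_bound[of _ 1]) (auto simp: h)
      note ik = integrable_power_unit_interval[OF K]
      have ip: "integrable K p"
        unfolding p_eq by (intro Bochner_Integration.integrable_sum integrable_mult_right ik)
      have "integral\<^sup>L K p = (\<Sum>i\<le>n. c i * integral\<^sup>L K (\<lambda>x. x ^ i))"
        unfolding p_eq by (simp add: ik)
      then have "\<bar>integral\<^sup>L K h - (\<Sum>i\<le>n. c i * integral\<^sup>L K (\<lambda>x. x ^ i))\<bar> = \<bar>integral\<^sup>L K (\<lambda>x. h x - p x)\<bar>"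
        using ih ip by simp
      also have "\<dots> \<le> integral\<^sup>L K (\<lambda>x. \<bar>h x - p x\<bar>)"
        by (rule integral_abs_bound)
      also have "\<dots> \<le> integral\<^sup>L K (\<lambda>_. d)"
      proof (rule integral_mono_AE)
        show "AE x in K. \<bar>h x - p x\<bar> \<le> d"
          using K(3) by eventually_elim (use p(2) in \<open>auto intro: less_imp_le\<close>)
      qed (use ih ip in auto)
      finally show ?thesis by (simp add: sp mult.commute)
    qed
    show ?thesis
      using approx[OF fin(1) sets(1) supp(1)] approx[OF fin(2) sets(2) supp(2)] d(2)
      by (simp add: moments distrib_left)
  qed
  then have "\<bar>integral\<^sup>L M h - integral\<^sup>L N h\<bar> \<le> 0"
    by (rule field_le_epsilon)
  then show "integral\<^sup>L M h = integral\<^sup>L N h" by simp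
qed

text \<open>Conditions on evaluations are introduced one at a time. The induction carries all
  \<open>u\<close> simultaneously, because the factor exp (- k \<mu> A) is absorbed by replacing
  \<open>u\<close> with \<open>u\<close> plus \<open>k\<close> times the indicator of
  \<open>A\<close>; the moments needed in the step are thus instances of the induction
  hypothesis.\<close>

lemma bfm_measure_eqI_laplace:
  fixes m1 m2 :: "'a::{metric_space, second_countable_topology} measure measure"
  assumes fin: "finite_measure m1" "finite_measure m2"
    and sets: "sets m1 = sets bfm_space" "sets m2 = sets bfm_space"
    and laplace: "\<And>u :: 'a \<Rightarrow> ennreal. u \<in> borel_measurable borel \<Longrightarrow> bounded {x. u x \<noteq> 0} \<Longrightarrow>
      (\<integral>\<^sup>+ \<mu>. exp_neg (\<integral>\<^sup>+ x. u x \<partial>\<mu>) \<partial>m1) = (\<integral>\<^sup>+ \<mu>. exp_neg (\<integral>\<^sup>+ x. u x \<partial>\<mu>) \<partial>m2)"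
  shows "m1 = m2"
proof -
  define J :: "('a set \<times> ennreal set) set" where
    "J = {(A, B). A \<in> sets borel \<and> bounded A \<and> B \<in> sets borel}"
  define S :: "('a set \<times> ennreal set) set \<Rightarrow> 'a measure set" where
    "S F = {\<mu>. boundedly_finite \<mu> \<and> (\<forall>(A, B)\<in>F. emeasure \<mu> A \<in> B)}" for F
  define L :: "('a \<Rightarrow> ennreal) \<Rightarrow> 'a measure \<Rightarrow> ennreal" where
    "L u \<mu> = exp_neg (\<integral>\<^sup>+ x. u x \<partial>\<mu>)" for u \<mu>
  have space_eq: "space m = {\<mu>. boundedly_finite \<mu>}" if "sets m = sets bfm_space" for m :: "'a measure measure"
    using sets_eq_imp_space_eq[OF that] by (simp add: space_bfm_space)
  have S_sets [measurable]: "S F \<in> sets bfm_space" if "finite F" "F \<subseteq> J" for F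
  proof -
    have "S F = {\<mu>\<in>space bfm_space. \<forall>c\<in>F. emeasure \<mu> (fst c) \<in> snd c}"
      by (auto simp: S_def space_bfm_space split_beta)
    also have "\<dots> \<in> sets bfm_space"
    proof (rule sets.sets_Collect_finite_All[OF _ that(1)])
      fix c assume "c \<in> F"
      then have "fst c \<in> sets borel" "bounded (fst c)" "snd c \<in> sets borel"
        using that(2) by (auto simp: J_def)
      then show "{\<mu>\<in>space bfm_space. emeasure \<mu> (fst c) \<in> snd c} \<in> sets bfm_space"
        using measurable_sets[OF measurable_emeasure_bfm_space, of "fst c" "snd c"]
        by (simp add: vimage_def Int_def conj_commute)
    qed
    finally show ?thesis .
  qed
  have L_meas: "L u \<in> borel_measurable bfm_space" if "u \<in> borel_measurable borel" for u
    unfolding L_def[abs_def] using measurable_nn_integral_bfm_space[OF that] by measurable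
  have key: "\<forall>u. u \<in> borel_measurable borel \<longrightarrow> bounded {x. u x \<noteq> 0} \<longrightarrow>
      (\<integral>\<^sup>+ \<mu>. indicator (S F) \<mu> * L u \<mu> \<partial>m1) = (\<integral>\<^sup>+ \<mu>. indicator (S F) \<mu> * L u \<mu> \<partial>m2)"
    if "finite F" "F \<subseteq> J" for F
    using that
    \<comment> \<open>Replace the factor \<open>exp (- k \<mu> A)\<close>, for all \<open>k\<close>, by the indicator of \<open>\<mu> A \<in> B\<close>: the image under
      \<open>exp (- \<mu> A)\<close> of the measure weighted by the remaining factors is determined by its moments.\<close>
  proof (induction F)
    case empty
    have "(\<integral>\<^sup>+ \<mu>. indicator (S {}) \<mu> * L u \<mu> \<partial>m) = (\<integral>\<^sup>+ \<mu>. L u \<mu> \<partial>m)"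
      if "sets m = sets bfm_space" for m u
      by (rule nn_integral_cong) (simp add: S_def space_eq[OF that])
    then show ?case
      using sets laplace by (simp add: L_def)
  next
    case (insert c F)
    obtain A B where c: "c = (A, B)" by (cases c)
    have AB: "A \<in> sets borel" "bounded A" "B \<in> sets borel" and F: "finite F" "F \<subseteq> J"
      using insert by (auto simp: J_def c)
    define \<phi> where "\<phi> \<mu> = enn2real (exp_neg (emeasure \<mu> A))" for \<mu> :: "'a measure"
    have \<phi>_meas: "\<phi> \<in> borel_measurable bfm_space"
      unfolding \<phi>_def[abs_def] using measurable_emeasure_bfm_space[OF AB(1,2)] by measurable
    have \<phi>_01: "\<phi> \<mu> \<in> {0..1}" for \<mu>
      using enn2real_mono[OF exp_neg_le_1[of "emeasure \<mu> A"]] by (simp add: \<phi>_def)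
    \<comment> \<open>The preimage of \<open>B\<close> under the inverse of exp (- t). Since
      \<open>A\<close> is bounded, \<mu> A is finite, so \<phi> is positive and the logarithm
      recovers \<mu> A exactly.\<close>
    define B' where "B' = {x :: real. ennreal (- ln x) \<in> B}"
    have B': "B' \<in> sets borel"
    proof -
      have "(\<lambda>x :: real. ennreal (- ln x)) -` B \<inter> space borel \<in> sets borel"
        by (rule measurable_sets[OF _ AB(3)]) measurable
      then show ?thesis by (simp add: B'_def vimage_def)
    qed
    show ?case
    proof (intro allI impI)
      fix u :: "'a \<Rightarrow> ennreal"
      assume u: "u \<in> borel_measurable borel" "bounded {x. u x \<noteq> 0}"
      define w where "w \<mu> = indicator (S F) \<mu> * L u \<mu>" for \<mu>
      have w_meas: "w \<in> borel_measurable bfm_space"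
        unfolding w_def[abs_def]
        by (intro borel_measurable_times_ennreal borel_measurable_indicator S_sets F L_meas u)
      have w_le: "w \<mu> \<le> 1" for \<mu>
        by (auto simp: w_def L_def indicator_def exp_neg_le_1)
      define n where "n m = distr (density m w) borel \<phi>" for m
      have n: "finite_measure (n m)" "sets (n m) = sets borel" "AE x in n m. x \<in> {0..1}"
        "emeasure (n m) B' = (\<integral>\<^sup>+ \<mu>. indicator (S (insert c F)) \<mu> * L u \<mu> \<partial>m)"
        "integral\<^sup>L (n m) (\<lambda>x. x ^ k)
           = enn2real (\<integral>\<^sup>+ \<mu>. indicator (S F) \<mu> * L (\<lambda>x. u x + of_nat k * indicator A x) \<mu> \<partial>m)"
        if m: "finite_measure m" "sets m = sets bfm_space" for m k
      proof -
        note cong = measurable_cong_sets[OF m(2) refl]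
        have [measurable]: "w \<in> borel_measurable m" "\<phi> \<in> borel_measurable m"
          using w_meas \<phi>_meas unfolding cong by auto
        note [measurable] = B'
        show "sets (n m) = sets borel"
          by (simp add: n_def)
        have "emeasure (n m) UNIV = (\<integral>\<^sup>+ \<mu>. w \<mu> * indicator (space m) \<mu> \<partial>m)"
          by (simp add: n_def emeasure_distr emeasure_density)
        also have "\<dots> \<le> (\<integral>\<^sup>+ \<mu>. indicator (space m) \<mu> \<partial>m)"
          by (intro nn_integral_mono) (auto simp: indicator_def w_le)
        also have "\<dots> < \<infinity>"
          using finite_measure.emeasure_finite[OF m(1)] by (simp add: less_top)
        finally show fin_n: "finite_measure (n m)"
          by (intro finite_measureI) (simp add: n_def)
        show AE_n: "AE x in n m. x \<in> {0..1}"
          unfolding n_def by (subst AE_distr_iff) (use \<phi>_01 in auto)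
        have "emeasure (n m) B' = (\<integral>\<^sup>+ \<mu>. w \<mu> * indicator (\<phi> -` B' \<inter> space m) \<mu> \<partial>m)"
          by (simp add: n_def emeasure_distr emeasure_density)
        also have "\<dots> = (\<integral>\<^sup>+ \<mu>. indicator (S (insert c F)) \<mu> * L u \<mu> \<partial>m)"
        proof (rule nn_integral_cong)
          fix \<mu> assume \<mu>: "\<mu> \<in> space m"
          then have bf: "boundedly_finite \<mu>" by (simp add: space_eq[OF m(2)])
          obtain r where r: "0 \<le> r" "emeasure \<mu> A = ennreal r"
            using boundedly_finiteD(3)[OF bf AB(1,2)] by (cases "emeasure \<mu> A") auto
          then have "\<phi> \<mu> \<in> B' \<longleftrightarrow> emeasure \<mu> A \<in> B"
            by (simp add: \<phi>_def B'_def exp_neg_ennreal)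
          then show "w \<mu> * indicator (\<phi> -` B' \<inter> space m) \<mu> = indicator (S (insert c F)) \<mu> * L u \<mu>"
            using \<mu> bf by (auto simp: w_def S_def c indicator_def)
        qed
        finally show "emeasure (n m) B' = (\<integral>\<^sup>+ \<mu>. indicator (S (insert c F)) \<mu> * L u \<mu> \<partial>m)" .
        have "integral\<^sup>L (n m) (\<lambda>x. x ^ k) = enn2real (\<integral>\<^sup>+ x. ennreal (x ^ k) \<partial>n m)"
          using AE_n by (intro integral_eq_nn_integral) (auto simp: n_def elim!: eventually_mono)
        also have "(\<integral>\<^sup>+ x. ennreal (x ^ k) \<partial>n m) = (\<integral>\<^sup>+ \<mu>. w \<mu> * ennreal (\<phi> \<mu> ^ k) \<partial>m)"
          by (simp add: n_def nn_integral_distr nn_integral_density)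
        also have "\<dots> = (\<integral>\<^sup>+ \<mu>. indicator (S F) \<mu> * L (\<lambda>x. u x + of_nat k * indicator A x) \<mu> \<partial>m)"
        proof (rule nn_integral_cong)
          fix \<mu> assume "\<mu> \<in> space m"
          then have bf: "boundedly_finite \<mu>" by (simp add: space_eq[OF m(2)])
          note s = boundedly_finiteD(1)[OF bf]
          have "(\<integral>\<^sup>+ x. u x + of_nat k * indicator A x \<partial>\<mu>) = (\<integral>\<^sup>+ x. u x \<partial>\<mu>) + of_nat k * emeasure \<mu> A"
            using u(1) AB(1) s by (subst nn_integral_add)
              (auto simp: nn_integral_cmult_indicator measurable_cong_sets[OF s refl])
          then have "L (\<lambda>x. u x + of_nat k * indicator A x) \<mu> = L u \<mu> * exp_neg (emeasure \<mu> A) ^ k"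
            by (simp add: L_def exp_neg_add exp_neg_of_nat_mult)
          moreover have "ennreal (\<phi> \<mu> ^ k) = exp_neg (emeasure \<mu> A) ^ k"
            using exp_neg_less_top[of "emeasure \<mu> A"] by (simp add: \<phi>_def flip: ennreal_power)
          ultimately show "w \<mu> * ennreal (\<phi> \<mu> ^ k)
              = indicator (S F) \<mu> * L (\<lambda>x. u x + of_nat k * indicator A x) \<mu>"
            by (simp add: w_def mult.assoc)
        qed
        finally show "integral\<^sup>L (n m) (\<lambda>x. x ^ k)
           = enn2real (\<integral>\<^sup>+ \<mu>. indicator (S F) \<mu> * L (\<lambda>x. u x + of_nat k * indicator A x) \<mu> \<partial>m)" .
      qed
      have "n m1 = n m2"
      proof (rule measure_eqI_moments_unit_interval)
        fix k
        have "(\<lambda>x. u x + of_nat k * indicator A x) \<in> borel_measurable borel"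
          using u(1) AB(1) by measurable
        moreover have "bounded {x. u x + of_nat k * indicator A x \<noteq> 0}"
          using bounded_Un[THEN iffD2, OF conjI, OF u(2) AB(2)]
          by (rule bounded_subset) (auto simp: indicator_def)
        ultimately show "integral\<^sup>L (n m1) (\<lambda>x. x ^ k) = integral\<^sup>L (n m2) (\<lambda>x. x ^ k)"
          using insert.IH[OF F(2)] by (simp add: n(5)[OF fin(1) sets(1)] n(5)[OF fin(2) sets(2)])
      qed (use n(1-3)[OF fin(1) sets(1)] n(1-3)[OF fin(2) sets(2)] in auto)
      then show "(\<integral>\<^sup>+ \<mu>. indicator (S (insert c F)) \<mu> * L u \<mu> \<partial>m1)
          = (\<integral>\<^sup>+ \<mu>. indicator (S (insert c F)) \<mu> * L u \<mu> \<partial>m2)"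
        using n(4)[OF fin(1) sets(1)] n(4)[OF fin(2) sets(2)] by simp
    qed
  qed
  let ?E = "S ` {F. finite F \<and> F \<subseteq> J}"
  have gen: "sets bfm_space = sigma_sets {\<mu>. boundedly_finite \<mu>} ?E"
  proof (rule antisym)
    show "sets bfm_space \<subseteq> sigma_sets {\<mu>. boundedly_finite \<mu>} ?E"
      unfolding sets_bfm_space_eq_evaluation_sets
    proof (rule sigma_sets_subseteq, rule subsetI)
      fix X :: "'a measure set" assume "X \<in> evaluation_sets"
      then obtain A B where "X = {\<mu>. boundedly_finite \<mu> \<and> emeasure \<mu> A \<in> B}" "(A, B) \<in> J"
        by (auto simp: evaluation_sets_def J_def)
      then show "X \<in> ?E"
        by (intro image_eqI[of _ _ "{(A, B)}"]) (auto simp: S_def)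
    qed
    have "sigma_sets (space bfm_space) ?E \<subseteq> sets (bfm_space :: 'a measure measure)"
      by (rule sets.sigma_sets_subset) (use S_sets in auto)
    then show "sigma_sets {\<mu>. boundedly_finite \<mu>} ?E \<subseteq> sets bfm_space"
      by (simp add: space_bfm_space)
  qed
  show ?thesis
  proof (rule measure_eqI_generator_eq[where E = ?E and A = "\<lambda>_. S {}"])
    show "Int_stable ?E"
    proof (rule Int_stableI_image)
      fix F G assume "F \<in> {F. finite F \<and> F \<subseteq> J}" "G \<in> {F. finite F \<and> F \<subseteq> J}"
      then show "\<exists>H\<in>{F. finite F \<and> F \<subseteq> J}. S F \<inter> S G = S H"
        by (intro bexI[of _ "F \<union> G"]) (auto simp: S_def)
    qed
    show "?E \<subseteq> Pow {\<mu>. boundedly_finite \<mu>}"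
      by (auto simp: S_def)
    show "sets m1 = sigma_sets {\<mu>. boundedly_finite \<mu>} ?E" "sets m2 = sigma_sets {\<mu>. boundedly_finite \<mu>} ?E"
      using sets gen by simp_all
    show "range (\<lambda>_ :: nat. S {}) \<subseteq> ?E" "(\<Union>i :: nat. S {}) = {\<mu>. boundedly_finite \<mu>}"
      by (auto simp: S_def)
    show "emeasure m1 (S {}) \<noteq> \<infinity>"
      using finite_measure.emeasure_finite[OF fin(1)] by simp
    fix X assume "X \<in> ?E"
    then obtain F where F: "finite F" "F \<subseteq> J" and X: "X = S F" by auto
    \<comment> \<open>For \<open>u = 0\<close> the weight \<open>L\<close> is 1, and
      \<open>key\<close> compares the two measures of \<open>S F\<close>.\<close>
    have "(\<integral>\<^sup>+ \<mu>. indicator (S F) \<mu> * L (\<lambda>_. 0) \<mu> \<partial>m1) = (\<integral>\<^sup>+ \<mu>. indicator (S F) \<mu> * L (\<lambda>_. 0) \<mu> \<partial>m2)"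
      using key[OF F] by simp
    then show "emeasure m1 X = emeasure m2 X"
      using S_sets[OF F] sets by (simp add: L_def X)
  qed
qed

section \<open>Change of measure\<close>

theorem lemma2p1:
  fixes \<nu> :: "'a::polish_space measure"
    and f :: "'a \<Rightarrow> real"
    and \<Omega> :: "'b measure" and N :: "'b \<Rightarrow> 'a measure"
    and \<Omega>' :: "'c measure" and N' :: "'c \<Rightarrow> 'a measure"
    and P Q :: "'a measure measure"
  assumes "boundedly_finite \<nu>"
    and "diffuse \<nu>"
    and "f \<in> borel_measurable borel"
    and "\<And>x. 0 \<le> f x"
    and "bounded {x. f x \<noteq> 0}"
    and "poisson_random_measure \<Omega> \<nu> N"
    and "P = distr \<Omega> bfm_space N"
    and "poisson_random_measure \<Omega>' (density \<nu> (\<lambda>x. ennreal (exp (- f x)))) N'"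
    and "Q = distr \<Omega>' bfm_space N'"
  shows "laplace_functional P f = ennreal (exp (- (\<integral>x. (1 - exp (- f x)) \<partial>\<nu>)))
    \<and> (\<forall>g :: 'a measure \<Rightarrow> ennreal. g \<in> borel_measurable bfm_space \<longrightarrow>
          (\<integral>\<^sup>+ \<mu>. g \<mu> * exp_neg_integral f \<mu> \<partial>P)
            = laplace_functional P f * (\<integral>\<^sup>+ \<mu>. g \<mu> \<partial>Q))
    \<and> density P (exp_neg_integral f) = scale_measure (laplace_functional P f) Q"
proof -
  note \<nu> = assms(1) and f_nonneg = assms(4) and f_supp = assms(5)
  note [measurable] = assms(3)
  note sets_\<nu> = boundedly_finiteD(1)[OF \<nu>]
  note cong_\<nu> = measurable_cong_sets[OF sets_\<nu> refl]
  let ?f = "\<lambda>x. ennreal (f x)"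
  let ?e = "\<lambda>x. ennreal (exp (- f x))"
  have exp_f: "exp_neg (?f x) = ?e x" for x
    by (rule exp_neg_ennreal[OF f_nonneg])
  have f_supp': "bounded {x. ?f x \<noteq> 0}"
    using f_supp by (rule bounded_subset) auto
  have e\<nu>: "boundedly_finite (density \<nu> ?e)"
    unfolding boundedly_finite_def
  proof (intro conjI ballI impI)
    show "sets (density \<nu> ?e) = sets borel"
      by (simp add: sets_\<nu>)
    fix A :: "'a set" assume A: "A \<in> sets borel" "bounded A"
    have "emeasure (density \<nu> ?e) A = (\<integral>\<^sup>+ x. ?e x * indicator A x \<partial>\<nu>)"
      using A by (intro emeasure_density) (auto simp: sets_\<nu> cong_\<nu>)
    also have "\<dots> \<le> (\<integral>\<^sup>+ x. indicator A x \<partial>\<nu>)"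
      by (intro nn_integral_mono) (auto simp: indicator_def f_nonneg)
    also have "\<dots> < \<infinity>"
      using A boundedly_finiteD(3)[OF \<nu> A] sets_\<nu> by simp
    finally show "emeasure (density \<nu> ?e) A < \<infinity>" .
  qed
  have meas: "(\<lambda>\<mu>. exp_neg (\<integral>\<^sup>+ x. u x \<partial>\<mu>)) \<in> borel_measurable bfm_space"
    if "u \<in> borel_measurable borel" for u :: "'a \<Rightarrow> ennreal"
    using measurable_nn_integral_bfm_space[OF that] by measurable
  have LP: "(\<integral>\<^sup>+ \<mu>. exp_neg (\<integral>\<^sup>+ x. u x \<partial>\<mu>) \<partial>P) = exp_neg (laplace_exponent u \<nu>)"
    if u: "u \<in> borel_measurable borel" "bounded {x. u x \<noteq> 0}" for u
    unfolding assms(7)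
    by (subst nn_integral_distr[OF poisson_random_measureD(2)[OF assms(6)]])
      (simp_all add: meas[OF u(1)] nn_integral_exp_neg_poisson[OF assms(6) \<nu> u])
  have LQ: "(\<integral>\<^sup>+ \<mu>. exp_neg (\<integral>\<^sup>+ x. u x \<partial>\<mu>) \<partial>Q) = exp_neg (laplace_exponent u (density \<nu> ?e))"
    if u: "u \<in> borel_measurable borel" "bounded {x. u x \<noteq> 0}" for u
    unfolding assms(9)
    by (subst nn_integral_distr[OF poisson_random_measureD(2)[OF assms(8)]])
      (simp_all add: meas[OF u(1)] nn_integral_exp_neg_poisson[OF assms(8) e\<nu> u])
  have eni_meas: "exp_neg_integral f \<in> borel_measurable bfm_space"
    unfolding exp_neg_integral_def[abs_def] by (rule meas) measurable
  have LF: "laplace_functional P f = exp_neg (laplace_exponent ?f \<nu>)"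
    unfolding laplace_functional_def exp_neg_integral_def by (rule LP[OF _ f_supp']) measurable
  have sets_PQ: "sets P = sets bfm_space" "sets Q = sets bfm_space"
    by (simp_all add: assms)
  interpret P: prob_space P
    unfolding assms(7) by (intro prob_space.prob_space_distr poisson_random_measureD[OF assms(6)])
  interpret Q: prob_space Q
    unfolding assms(9) by (intro prob_space.prob_space_distr poisson_random_measureD[OF assms(8)])
  have eni_P: "exp_neg_integral f \<in> borel_measurable P"
    using eni_meas unfolding measurable_cong_sets[OF sets_PQ(1) refl] .
  have add: "laplace_exponent (\<lambda>x. ?f x + u x) \<nu> = laplace_exponent ?f \<nu> + laplace_exponent u (density \<nu> ?e)"
    if [measurable]: "u \<in> borel_measurable borel" for u
  proof -
    have split: "1 - exp_neg (?f x + u x) = (1 - exp_neg (?f x)) + ?e x * (1 - exp_neg (u x))" for x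
    proof -
      \<comment> \<open>Subtraction in \<open>ennreal\<close> is truncated, so the identity is
        checked in the reals, where all exponentials lie in [0,1] and nothing is cut off. The case
        of infinite \<open>u x\<close> is included as \<open>t = 0\<close>.\<close>
      obtain t where t: "0 \<le> t" "t \<le> 1" "exp_neg (u x) = ennreal t"
        using exp_neg_le_1[of "u x"] by (cases "exp_neg (u x)") (auto simp: top_unique)
      have "(1 - exp_neg (?f x)) + ?e x * (1 - exp_neg (u x))
          = ennreal (1 - exp (- f x)) + ennreal (exp (- f x) * (1 - t))"
        using t unfolding exp_f t(3) by (simp add: ennreal_minus ennreal_mult flip: ennreal_1)
      also have "\<dots> = ennreal (1 - exp (- f x) * t)"
        using t f_nonneg[of x] by (subst ennreal_plus[symmetric]) (auto simp: right_diff_distrib)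
      also have "\<dots> = 1 - exp_neg (?f x + u x)"
        using t unfolding exp_neg_add exp_f t(3)
        by (simp add: ennreal_minus flip: ennreal_1 ennreal_mult)
      finally show ?thesis by (rule sym)
    qed
    have m: "(\<lambda>x. 1 - exp_neg (?f x)) \<in> borel_measurable \<nu>" "?e \<in> borel_measurable \<nu>"
      "(\<lambda>x. 1 - exp_neg (u x)) \<in> borel_measurable \<nu>"
      unfolding cong_\<nu> by measurable
    show ?thesis
      unfolding laplace_exponent_def split nn_integral_density[OF m(2,3)]
      by (intro nn_integral_add m borel_measurable_times_ennreal)
  qed
  have main: "density P (exp_neg_integral f) = scale_measure (laplace_functional P f) Q"
  proof (rule bfm_measure_eqI_laplace)
    show "sets (density P (exp_neg_integral f)) = sets bfm_space"
      "sets (scale_measure (laplace_functional P f) Q) = sets bfm_space"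
      by (simp_all add: sets_PQ)
    have "emeasure (density P (exp_neg_integral f)) (space P) = laplace_functional P f"
      using eni_P by (simp add: emeasure_density laplace_functional_def cong: nn_integral_cong)
    then show "finite_measure (density P (exp_neg_integral f))"
      using exp_neg_less_top[of "laplace_exponent ?f \<nu>"] by (intro finite_measureI) (auto simp: LF)
    show "finite_measure (scale_measure (laplace_functional P f) Q)"
      using exp_neg_less_top[of "laplace_exponent ?f \<nu>"]
      by (intro finite_measureI) (simp add: LF space_scale_measure Q.emeasure_space_1)
    fix u :: "'a \<Rightarrow> ennreal"
    assume u [measurable]: "u \<in> borel_measurable borel" and u_supp: "bounded {x. u x \<noteq> 0}"
    have mP: "(\<lambda>\<mu>. exp_neg (\<integral>\<^sup>+ x. u x \<partial>\<mu>)) \<in> borel_measurable P"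
      and mQ: "(\<lambda>\<mu>. exp_neg (\<integral>\<^sup>+ x. u x \<partial>\<mu>)) \<in> borel_measurable Q"
      using meas[OF u]
      by (simp_all add: measurable_cong_sets[OF sets_PQ(1) refl] measurable_cong_sets[OF sets_PQ(2) refl])
    have "(\<integral>\<^sup>+ \<mu>. exp_neg (\<integral>\<^sup>+ x. u x \<partial>\<mu>) \<partial>density P (exp_neg_integral f))
        = (\<integral>\<^sup>+ \<mu>. exp_neg_integral f \<mu> * exp_neg (\<integral>\<^sup>+ x. u x \<partial>\<mu>) \<partial>P)"
      by (rule nn_integral_density[OF eni_P mP])
    also have "\<dots> = (\<integral>\<^sup>+ \<mu>. exp_neg (\<integral>\<^sup>+ x. ?f x + u x \<partial>\<mu>) \<partial>P)"
    proof (rule nn_integral_cong)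
      fix \<mu> assume "\<mu> \<in> space P"
      then have "boundedly_finite \<mu>"
        using sets_eq_imp_space_eq[OF sets_PQ(1)] by (simp add: space_bfm_space)
      note s = boundedly_finiteD(1)[OF this]
      have "?f \<in> borel_measurable \<mu>" "u \<in> borel_measurable \<mu>"
        unfolding measurable_cong_sets[OF s refl] by measurable
      then show "exp_neg_integral f \<mu> * exp_neg (\<integral>\<^sup>+ x. u x \<partial>\<mu>) = exp_neg (\<integral>\<^sup>+ x. ?f x + u x \<partial>\<mu>)"
        by (simp add: nn_integral_add exp_neg_add exp_neg_integral_def)
    qed
    also have "\<dots> = exp_neg (laplace_exponent (\<lambda>x. ?f x + u x) \<nu>)"
    proof (rule LP)
      show "bounded {x. ?f x + u x \<noteq> 0}"
        using bounded_Un[THEN iffD2, OF conjI, OF f_supp' u_supp] by (rule bounded_subset) auto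
    qed measurable
    also have "\<dots> = laplace_functional P f * (\<integral>\<^sup>+ \<mu>. exp_neg (\<integral>\<^sup>+ x. u x \<partial>\<mu>) \<partial>Q)"
      by (simp add: add[OF u] exp_neg_add LF LQ[OF u u_supp])
    also have "\<dots> = (\<integral>\<^sup>+ \<mu>. exp_neg (\<integral>\<^sup>+ x. u x \<partial>\<mu>) \<partial>scale_measure (laplace_functional P f) Q)"
      by (rule nn_integral_scale_measure[OF mQ, symmetric])
    finally show "(\<integral>\<^sup>+ \<mu>. exp_neg (\<integral>\<^sup>+ x. u x \<partial>\<mu>) \<partial>density P (exp_neg_integral f))
        = (\<integral>\<^sup>+ \<mu>. exp_neg (\<integral>\<^sup>+ x. u x \<partial>\<mu>) \<partial>scale_measure (laplace_functional P f) Q)" .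
  qed
  have "laplace_functional P f = ennreal (exp (- (\<integral>x. (1 - exp (- f x)) \<partial>\<nu>)))"
  proof -
    \<comment> \<open>Even for unbounded \<open>f\<close> the integrand lies between 0 and 1 and
      vanishes off the bounded support of \<open>f\<close>; this turns the \<open>ennreal\<close>
      exponent into a Bochner integral.\<close>
    have "integrable \<nu> (\<lambda>x. 1 - exp (- f x))"
    proof (rule integrable_boundedly_finite[OF \<nu>])
      show "bounded (range (\<lambda>x. 1 - exp (- f x)))"
        unfolding bounded_iff by (intro exI[of _ 1]) (auto simp: f_nonneg)
      show "bounded {x. 1 - exp (- f x) \<noteq> 0}"
        using f_supp by (rule bounded_subset) auto
    qed measurable
    then have "(\<integral>\<^sup>+ x. ennreal (1 - exp (- f x)) \<partial>\<nu>) = ennreal (\<integral>x. 1 - exp (- f x) \<partial>\<nu>)"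
      by (rule nn_integral_eq_integral) (simp add: f_nonneg)
    moreover have "1 - exp_neg (?f x) = ennreal (1 - exp (- f x))" for x
      unfolding exp_f by (simp add: ennreal_minus flip: ennreal_1)
    moreover have "0 \<le> (\<integral>x. 1 - exp (- f x) \<partial>\<nu>)"
      by (intro integral_nonneg_AE) (simp add: f_nonneg)
    ultimately show ?thesis
      unfolding LF laplace_exponent_def by (simp add: exp_neg_ennreal)
  qed
  moreover have "(\<integral>\<^sup>+ \<mu>. g \<mu> * exp_neg_integral f \<mu> \<partial>P) = laplace_functional P f * (\<integral>\<^sup>+ \<mu>. g \<mu> \<partial>Q)"
    if g: "g \<in> borel_measurable bfm_space" for g :: "'a measure \<Rightarrow> ennreal"
  proof -
    have gP: "g \<in> borel_measurable P" and gQ: "g \<in> borel_measurable Q"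
      using g
      by (simp_all add: measurable_cong_sets[OF sets_PQ(1) refl] measurable_cong_sets[OF sets_PQ(2) refl])
    have "(\<integral>\<^sup>+ \<mu>. g \<mu> * exp_neg_integral f \<mu> \<partial>P) = (\<integral>\<^sup>+ \<mu>. g \<mu> \<partial>density P (exp_neg_integral f))"
      by (simp add: nn_integral_density[OF eni_P gP] mult.commute)
    also have "\<dots> = laplace_functional P f * (\<integral>\<^sup>+ \<mu>. g \<mu> \<partial>Q)"
      unfolding main by (rule nn_integral_scale_measure[OF gQ])
    finally show ?thesis .
  qed
  ultimately show ?thesis
    using main by blast
qed

end
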